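(* Let a fully-strict fork-join program be executed by libfork with $P \ge 1$ workers, let $c$ be the size in bytes of the metadata region of a stacklet, and let $M_1$ be the maximum, over all paths through the program's DAG, of the sum of the sizes in bytes of the tasks on the path. Then the stack memory $M_p$ in bytes used by libfork during the execution satisfies $$M_p \le (2c+3)\,P\,M_1 .$$
   Context: All sizes are in bytes. **Programs.** In the fork-join model a task may execute: fork (create a child task that may run concurrently with the continuation of the parent), call (run a child task and wait for it), and join (wait until all children forked by this task have completed). The program is fully strict: all children of a task complete before the task itself completes. An execution determines a directed acyclic graph (DAG) expressing parent-child dependencies between tasks, starting from a single root task; a path through the DAG is a chain of tasks starting at the root in which each task is a child of the previous one, each task being counted once. Each task is a coroutine whose local variables live in a non-relocatable frame; the size of a task is the size of its frame and is at least $1$ byte. $M_1$ is the sum of the task sizes along the path through the DAG that maximizes this sum, i.e. the maximum stack usage of a single worker executing the program depth-first on a linear stack without overhead. **Segmented stacks.** A segmented stack is a doubly-linked list of stacklets. A stacklet consists of a contiguous stack region of some size $k$, plus a metadata region of fixed size $c$ (in libfork, $c=48$), so it occupies $k+c$ bytes. Allocations and deallocations on a segmented stack occur in first-in-last-out order; each allocation has size at least $1$ and lies entirely inside one stacklet. If an allocation fits in the remaining space of the current top stacklet it is placed there; otherwise a new stacklet is obtained from the heap, with stack region twice as large as that of the previous stacklet or just large enough to fit the allocation, whichever is greater (the first stacklet, having no predecessor, is just large enough for the allocation). If a stacklet becomes empty after a deallocation, it may be kept as a cached stacklet after the top one (provided its stack region is not more than twice as large as that of the previous stacklet), otherwise it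 is freed; each stack has at most one cached stacklet. The memory used by a segmented stack is the sum of $k+c$ over all its stacklets, including the cached one. "Stack memory used by libfork" is the total memory used by the segmented stacks holding task frames. **Scheduler.** There are $P$ workers. Each owns a current segmented stack $g$ and a work-stealing queue (WSQ): the owner pushes and pops in last-in-first-out order, and any other worker may steal the oldest element. One worker starts with the root task; a worker with no task repeatedly attempts to steal from other workers' queues, and on success resumes the stolen (suspended) parent task, keeping its own empty stack for newly created children. - Fork: the worker allocates the child's frame on its current stack $g$, records $g$ as the stack of the child and the current task as the child's parent, pushes the parent's continuation onto its own WSQ, and immediately executes the child. A call does the same without the push. - Join by task $t$: if $t$ has not been stolen, the worker continues $t$. Otherwise $t$ is atomically marked as at a join point and its join counter is decreased; if all forked children of $t$ have already completed (this worker is the last to join), the worker replaces its current (empty) stack by the stack of $t$ and continues $t$; otherwise the worker goes back to stealing. - Return of task $t$ with parent $p$: the worker deallocates the frame of $t$ from its current stack $g$. If $t$ is the root, the execution ends. If $t$ was called, the worker resumes $p$. If $t$ was forked and the worker can pop $p$ from its own WSQ, it resumes $p$. Otherwise it atomically decreases the join counter of $p$; if $p$ is at a join point and this worker is the last to join $p$, then it makes the stack $g_p$ of $p$ its current stack (if $g\neq g_p$, its previous stack $g$ being empty) and resumes $p$; else, if $g=g_p$, it releases $g_p$ and takes a new empty stack as its current stack, and in either case goes back to stealing.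
   Formalization: The formal theorem assumes that the metadata region has size c ≥ 2 bytes (room for the two links of a doubly-linked list); for c = 0 or 1 the stated bound fails, e.g. for many released stacks with regions k, 2k and a cached 4k holding only k+1 live bytes. *)

theory Defs
  imports Main
begin

section \<open>Fork-join programs\<close>

text \<open>
  A program is given by its root task, unfolded into the finite tree of all tasks it executes.
  All sizes are in bytes.
\<close>

datatype task = Task (frame_size: nat) (body: "instr list")
  and instr = Fork task | Call task | Join

definition children :: "task \<Rightarrow> task set" where
  "children t = {u. Fork u \<in> set (body t) \<or> Call u \<in> set (body t)}"

inductive_set tasks_of :: "task \<Rightarrow> task set" for root where
  root: "root \<in> tasks_of root"
| child: "t \<in> tasks_of root \<Longrightarrow> u \<in> children t \<Longrightarrow> u \<in> tasks_of root"

definition dag_path :: "task \<Rightarrow> task list \<Rightarrow> bool" where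
  "dag_path root ts \<longleftrightarrow> ts \<noteq> [] \<and> hd ts = root \<and> successively (\<lambda>t u. u \<in> children t) ts"

definition M1 :: "task \<Rightarrow> nat" where
  "M1 root = Max {sum_list (map frame_size ts) | ts. dag_path root ts}"

text \<open>
  A called child completes before its parent continues, so all children of a task complete before
  the task itself does exactly if every fork is followed by a join of the same task.
\<close>

definition fully_strict :: "task \<Rightarrow> bool" where
  "fully_strict root \<longleftrightarrow> (\<forall>t \<in> tasks_of root. \<forall>i < length (body t). \<forall>u.
     body t ! i = Fork u \<longrightarrow> (\<exists>j. i < j \<and> j < length (body t) \<and> body t ! j = Join))"

definition nonempty_frames :: "task \<Rightarrow> bool" where
  "nonempty_frames root \<longleftrightarrow> (\<forall>t \<in> tasks_of root. frame_size t \<ge> 1)"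


section \<open>Segmented stacks\<close>

text \<open>
  Stacklets and the allocations within a stacklet are listed most recent first. The cached
  stacklet, which holds no allocation, is represented by the size of its stack region; it sits
  after the first element of \<open>stacklets\<close>.
\<close>

record stacklet =
  region :: nat
  allocs :: "nat list"

record segstack =
  stacklets :: "stacklet list"
  cached :: "nat option"

definition empty_stack :: segstack where
  "empty_stack = \<lparr>stacklets = [], cached = None\<rparr>"

definition fits :: "nat \<Rightarrow> stacklet \<Rightarrow> bool" where
  "fits m k \<longleftrightarrow> sum_list (allocs k) + m \<le> region k"

text \<open>
  A cached stacklet too small for the allocation is freed. One that is large enough is reused: it
  was created as the successor of the current top stacklet.
\<close>

definition alloc :: "nat \<Rightarrow> segstack \<Rightarrow> segstack" where
  "alloc m s = (case stacklets s of
     [] \<Rightarrow> \<lparr>stacklets = [\<lparr>region = m, allocs = [m]\<rparr>], cached = None\<rparr>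
   | k # ks \<Rightarrow>
       if fits m k then s\<lparr>stacklets := k\<lparr>allocs := m # allocs k\<rparr> # ks\<rparr>
       else
         let r = (case cached s of
                    Some r' \<Rightarrow> if m \<le> r' then r' else max (2 * region k) m
                  | None \<Rightarrow> max (2 * region k) m)
         in \<lparr>stacklets = \<lparr>region = r, allocs = [m]\<rparr> # k # ks, cached = None\<rparr>)"

text \<open>
  Deallocation removes the most recent allocation. An emptied stacklet may be kept as the cached
  one or freed; in both cases the stacklet that was cached after it is freed. An emptied first
  stacklet has no predecessor and is freed.
\<close>

inductive dealloc :: "segstack \<Rightarrow> segstack \<Rightarrow> bool" where
  shrink: "stacklets s = k # ks \<Longrightarrow> allocs k = m # as \<Longrightarrow> as \<noteq> [] \<Longrightarrow>
     dealloc s (s\<lparr>stacklets := k\<lparr>allocs := as\<rparr> # ks\<rparr>)"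
| free: "stacklets s = k # ks \<Longrightarrow> allocs k = [m] \<Longrightarrow>
     dealloc s \<lparr>stacklets = ks, cached = None\<rparr>"
| cache: "stacklets s = k # k' # ks \<Longrightarrow> allocs k = [m] \<Longrightarrow> region k \<le> 2 * region k' \<Longrightarrow>
     dealloc s \<lparr>stacklets = k' # ks, cached = Some (region k)\<rparr>"

text \<open>
  The metadata region of a stacklet, of size \<open>c\<close>, contains the two links of the doubly-linked list,
  each of at least 1 byte.
\<close>

definition segstack_memory :: "nat \<Rightarrow> segstack \<Rightarrow> nat" where
  "segstack_memory c s = (\<Sum>k \<leftarrow> stacklets s. region k + c) +
     (case cached s of None \<Rightarrow> 0 | Some r \<Rightarrow> r + c)"


section \<open>Scheduler\<close>

text \<open>
  Workers are numbered from 0. Activated tasks are identified by numbers, segmented stacks by their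
  index in \<open>stacks\<close>; that list only ever grows, and keeps abandoned (empty) stacks.
  The flag \<open>stolen\<close> is about thefts since the last completed join of the task,
  \<open>at_join\<close> marks a task suspended at a join point, \<open>home\<close> is the stack on which its frame was
  allocated, and \<open>own\<close> is the current stack of a worker.
\<close>

record frame =
  parent :: "nat option"
  forked :: bool
  home :: nat
  rest :: "instr list"
  stolen :: bool
  at_join :: bool

record config =
  frames :: "nat \<rightharpoonup> frame"
  stacks :: "segstack list"
  current :: "nat \<Rightarrow> nat option"
  own :: "nat \<Rightarrow> nat"
  wsq :: "nat \<Rightarrow> nat list"

text \<open>The property of a task that its join counter detects.\<close>

definition children_done :: "config \<Rightarrow> nat \<Rightarrow> bool" where
  "children_done s p \<longleftrightarrow> \<not> (\<exists>u f. frames s u = Some f \<and> forked f \<and> parent f = Some p)"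

text \<open>
  Worker \<open>w\<close>, executing \<open>t\<close> with frame \<open>f\<close> and remaining body \<open>r\<close>, starts child \<open>u\<close> under the
  identifier \<open>n\<close>.
\<close>

definition start_child ::
  "nat \<Rightarrow> nat \<Rightarrow> frame \<Rightarrow> instr list \<Rightarrow> bool \<Rightarrow> task \<Rightarrow> nat \<Rightarrow> config \<Rightarrow> config" where
  "start_child w t f r frk u n s = s\<lparr>
     frames := (frames s)(t \<mapsto> f\<lparr>rest := r\<rparr>,
       n \<mapsto> \<lparr>parent = Some t, forked = frk, home = own s w, rest = body u,
            stolen = False, at_join = False\<rparr>),
     stacks := (stacks s)[own s w := alloc (frame_size u) (stacks s ! own s w)],
     current := (current s)(w := Some n)\<rparr>"

text \<open>Worker \<open>w\<close> deallocates the frame of \<open>t\<close>, which turns its current stack into \<open>g\<close>.\<close>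

definition drop_frame :: "nat \<Rightarrow> nat \<Rightarrow> segstack \<Rightarrow> config \<Rightarrow> config" where
  "drop_frame w t g s = s\<lparr>
     frames := (frames s)(t := None),
     stacks := (stacks s)[own s w := g]\<rparr>"

text \<open>Queues are listed oldest element first: owners work at the back, thieves at the front.\<close>

inductive step :: "nat \<Rightarrow> config \<Rightarrow> config \<Rightarrow> bool" for P where
  fork: "w < P \<Longrightarrow> current s w = Some t \<Longrightarrow> frames s t = Some f \<Longrightarrow>
     rest f = Fork u # r \<Longrightarrow> frames s n = None \<Longrightarrow>
     step P s ((start_child w t f r True u n s)\<lparr>wsq := (wsq s)(w := wsq s w @ [t])\<rparr>)"
| call: "w < P \<Longrightarrow> current s w = Some t \<Longrightarrow> frames s t = Some f \<Longrightarrow>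
     rest f = Call u # r \<Longrightarrow> frames s n = None \<Longrightarrow>
     step P s (start_child w t f r False u n s)"
| steal: "w < P \<Longrightarrow> current s w = None \<Longrightarrow> v < P \<Longrightarrow> v \<noteq> w \<Longrightarrow> wsq s v = p # q \<Longrightarrow>
     frames s p = Some f \<Longrightarrow>
     step P s (s\<lparr>
       frames := (frames s)(p \<mapsto> f\<lparr>stolen := True\<rparr>),
       current := (current s)(w := Some p),
       wsq := (wsq s)(v := q)\<rparr>)"
| join_unstolen: "w < P \<Longrightarrow> current s w = Some t \<Longrightarrow> frames s t = Some f \<Longrightarrow>
     rest f = Join # r \<Longrightarrow> \<not> stolen f \<Longrightarrow>
     step P s (s\<lparr>frames := (frames s)(t \<mapsto> f\<lparr>rest := r\<rparr>)\<rparr>)"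
| join_last: "w < P \<Longrightarrow> current s w = Some t \<Longrightarrow> frames s t = Some f \<Longrightarrow>
     rest f = Join # r \<Longrightarrow> stolen f \<Longrightarrow> children_done s t \<Longrightarrow>
     step P s (s\<lparr>
       frames := (frames s)(t \<mapsto> f\<lparr>rest := r, stolen := False\<rparr>),
       own := (own s)(w := home f)\<rparr>)"
| join_wait: "w < P \<Longrightarrow> current s w = Some t \<Longrightarrow> frames s t = Some f \<Longrightarrow>
     rest f = Join # r \<Longrightarrow> stolen f \<Longrightarrow> \<not> children_done s t \<Longrightarrow>
     step P s (s\<lparr>
       frames := (frames s)(t \<mapsto> f\<lparr>rest := r, at_join := True\<rparr>),
       current := (current s)(w := None)\<rparr>)"
| return_root: "w < P \<Longrightarrow> current s w = Some t \<Longrightarrow> frames s t = Some f \<Longrightarrow>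
     rest f = [] \<Longrightarrow> parent f = None \<Longrightarrow> dealloc (stacks s ! own s w) g \<Longrightarrow>
     step P s ((drop_frame w t g s)\<lparr>current := (current s)(w := None)\<rparr>)"
| return_called: "w < P \<Longrightarrow> current s w = Some t \<Longrightarrow> frames s t = Some f \<Longrightarrow>
     rest f = [] \<Longrightarrow> parent f = Some p \<Longrightarrow> \<not> forked f \<Longrightarrow>
     dealloc (stacks s ! own s w) g \<Longrightarrow>
     step P s ((drop_frame w t g s)\<lparr>current := (current s)(w := Some p)\<rparr>)"
| return_pop: "w < P \<Longrightarrow> current s w = Some t \<Longrightarrow> frames s t = Some f \<Longrightarrow>
     rest f = [] \<Longrightarrow> parent f = Some p \<Longrightarrow> forked f \<Longrightarrow>
     dealloc (stacks s ! own s w) g \<Longrightarrow> wsq s w = q @ [p] \<Longrightarrow>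
     step P s ((drop_frame w t g s)\<lparr>
       current := (current s)(w := Some p),
       wsq := (wsq s)(w := q)\<rparr>)"
| return_last: "w < P \<Longrightarrow> current s w = Some t \<Longrightarrow> frames s t = Some f \<Longrightarrow>
     rest f = [] \<Longrightarrow> parent f = Some p \<Longrightarrow> forked f \<Longrightarrow>
     dealloc (stacks s ! own s w) g \<Longrightarrow> \<not> (\<exists>q. wsq s w = q @ [p]) \<Longrightarrow>
     s' = drop_frame w t g s \<Longrightarrow> frames s' p = Some fp \<Longrightarrow>
     at_join fp \<and> children_done s' p \<Longrightarrow>
     step P s (s'\<lparr>
       frames := (frames s')(p \<mapsto> fp\<lparr>stolen := False, at_join := False\<rparr>),
       current := (current s)(w := Some p),
       own := (own s)(w := home fp)\<rparr>)"
| return_not_last: "w < P \<Longrightarrow> current s w = Some t \<Longrightarrow> frames s t = Some f \<Longrightarrow>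
     rest f = [] \<Longrightarrow> parent f = Some p \<Longrightarrow> forked f \<Longrightarrow>
     dealloc (stacks s ! own s w) g \<Longrightarrow> \<not> (\<exists>q. wsq s w = q @ [p]) \<Longrightarrow>
     s' = drop_frame w t g s \<Longrightarrow> frames s' p = Some fp \<Longrightarrow>
     \<not> (at_join fp \<and> children_done s' p) \<Longrightarrow>
     step P s (if own s w = home fp
       then s'\<lparr>
         stacks := stacks s' @ [empty_stack],
         current := (current s)(w := None),
         own := (own s)(w := length (stacks s'))\<rparr>
       else s'\<lparr>current := (current s)(w := None)\<rparr>)"

definition initial :: "nat \<Rightarrow> task \<Rightarrow> config \<Rightarrow> bool" where
  "initial P root s \<longleftrightarrow> (\<exists>w < P. s = \<lparr>
     frames = [0 \<mapsto> \<lparr>parent = None, forked = False, home = w, rest = body root,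
                   stolen = False, at_join = False\<rparr>],
     stacks = (replicate P empty_stack)[w := alloc (frame_size root) empty_stack],
     current = (\<lambda>_. None)(w := Some 0),
     own = (\<lambda>v. v),
     wsq = (\<lambda>_. [])\<rparr>)"

definition reachable :: "nat \<Rightarrow> task \<Rightarrow> config \<Rightarrow> bool" where
  "reachable P root s \<longleftrightarrow> (\<exists>s0. initial P root s0 \<and> (step P)\<^sup>*\<^sup>* s0 s)"

definition stack_memory :: "nat \<Rightarrow> config \<Rightarrow> nat" where
  "stack_memory c s = (\<Sum>g \<leftarrow> stacks s. segstack_memory c g)"

end

theory Submission
  imports Defs
begin

text \<open>
  The memory of a segmented stack is at most \<open>2 * c + 3\<close> times the number of bytes allocated on it:
  a stacklet is only opened when an allocation overflows the previous one, so a doubled region is paid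
  for by the allocations in two consecutive stacklets, and metadata is paid for by allocations being
  nonempty. It remains to bound the total size of the live frames. They form a tree of which every leaf
  is being executed by some worker, hence they are covered by \<open>P\<close> paths from the root, each of size at
  most \<open>M1 root\<close>.

  That stacks hold exactly the live frames requires that a returning task finds its own frame on top of
  its worker's stack. This is because each stack holds a descending path of the task tree whose bottom
  frame is the root or a child of a stolen task, and the worker of a task owns the task's home stack
  unless the task is stolen, in which case the worker's stack is empty.
\<close>

section \<open>Memory of a segmented stack\<close>

text \<open>The number of stacks is not bounded by \<open>P\<close>: a worker that leaves its stack
  to an unfinished parent gets a fresh one. So memory is compared with the live bytes as a whole.
  The constant is attained by one live byte in a one-byte stacklet followed by a cached stacklet of
  two bytes: together they take \<open>2 * c + 3\<close> bytes.

  A leaf of the task tree is being executed because every way of being suspended involves a live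
  child: a queued task has forked one, a caller waits for one, and a task at a join point still
  misses one. Strictness ensures that a stolen task has a \<open>Join\<close> ahead of it, so that
  no task returns while it is marked as stolen.

  The obstacle is that \<open>stolen\<close> outlives the theft. It is reset only by a completed
  join, so a stolen task can fork again, be queued, and be resumed or stolen once more, all while
  its frame lies on a stack other than that of its worker. Comparing the homes of parent and child
  tells an old theft from one that has separated the two.\<close>

definition contents :: "segstack \<Rightarrow> nat list" where
  "contents s = concat (map allocs (stacklets s))"

text \<open>
  The top stacklet \<open>k\<close> was opened because its first allocation, \<open>last (allocs k)\<close>, did not fit into the
  stacklet before it, which has not changed since.
\<close>

fun linked :: "stacklet list \<Rightarrow> bool" where
  "linked [] \<longleftrightarrow> True"
| "linked [k] \<longleftrightarrow> allocs k \<noteq> [] \<and> region k \<le> last (allocs k)"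
| "linked (k # k' # ks) \<longleftrightarrow> allocs k \<noteq> [] \<and> region k \<le> max (2 * region k') (last (allocs k)) \<and>
     region k' < sum_list (allocs k') + last (allocs k) \<and> linked (k' # ks)"

text \<open>Thanks to the bound on a cached region, a reused cached stacklet meets the size
  condition of \<open>linked\<close> just like a freshly doubled one.\<close>

definition valid_stack :: "segstack \<Rightarrow> bool" where
  "valid_stack s \<longleftrightarrow> linked (stacklets s) \<and>
     (\<forall>r. cached s = Some r \<longrightarrow> (\<exists>k ks. stacklets s = k # ks \<and> r \<le> 2 * region k))"

text \<open>The condition on a top stacklet mentions only its region and its oldest allocation, so
  it survives pushes and pops above that allocation. The total of its allocations matters only once
  another stacklet lies above it, and then it is frozen.\<close>

lemma linked_replace_top:
  assumes "linked (k # ks)" "region k' = region k" "allocs k' \<noteq> []"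
    "last (allocs k') = last (allocs k)"
  shows "linked (k' # ks)"
  using assms by (cases ks) auto

lemma linked_nonempty: "linked (k # ks) \<Longrightarrow> allocs k \<noteq> []"
  by (cases ks) auto

lemma linked_tl: "linked (k # ks) \<Longrightarrow> linked ks"
  by (cases ks) auto

lemma valid_empty_stack: "valid_stack empty_stack" "contents empty_stack = []"
  by (auto simp: valid_stack_def empty_stack_def contents_def)

lemma contents_alloc: "contents (alloc m s) = m # contents s"
  by (auto simp: contents_def alloc_def Let_def split: list.split)

lemma valid_stack_alloc:
  assumes "valid_stack s"
  shows "valid_stack (alloc m s)"
proof (cases "stacklets s")
  case Nil
  then show ?thesis by (auto simp: valid_stack_def alloc_def)
next
  case (Cons k ks)
  have lk: "linked (k # ks)" using assms Cons by (auto simp: valid_stack_def)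
  show ?thesis
  proof (cases "fits m k")
    case True
    have "linked (k\<lparr>allocs := m # allocs k\<rparr> # ks)"
      by (rule linked_replace_top[OF lk]) (use linked_nonempty[OF lk] in auto)
    then show ?thesis using assms Cons True by (auto simp: valid_stack_def alloc_def)
  next
    case False
    then show ?thesis using assms Cons lk
      by (auto simp: valid_stack_def alloc_def fits_def Let_def not_le split: option.split)
  qed
qed

lemma dealloc_valid:
  assumes "dealloc s s'" "valid_stack s"
  shows "valid_stack s' \<and> contents s' = tl (contents s)"
  using assms
proof (induction rule: dealloc.induct)
  case (shrink s k ks m as)
  have "linked (k # ks)" using shrink by (auto simp: valid_stack_def)
  then have "linked (k\<lparr>allocs := as\<rparr> # ks)"
    by (rule linked_replace_top) (use shrink in auto)
  then show ?case
    using shrink by (auto simp: valid_stack_def contents_def)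
qed (auto simp: valid_stack_def contents_def dest: linked_tl)

text \<open>
  The summand \<open>2 * region k + c\<close> accounts for a cached stacklet. If the region of \<open>k\<close> comes from doubling
  that of its predecessor \<open>k'\<close>, both are charged to the allocations in \<open>k'\<close> and the first one in \<open>k\<close>, and
  the induction continues below \<open>k'\<close>.
\<close>

lemma linked_memory:
  assumes "linked (k # ks)" "\<forall>m \<in> set (concat (map allocs (k # ks))). 1 \<le> m" "2 \<le> c"
  shows "(\<Sum>k \<leftarrow> k # ks. region k + c) + 2 * region k + c
    \<le> (2 * c + 3) * sum_list (concat (map allocs (k # ks)))"
  using assms(1,2)
proof (induction "length ks" arbitrary: k ks rule: less_induct)
  case less
  define a where "a = sum_list (allocs k)"
  define f where "f = last (allocs k)"
  have ne: "allocs k \<noteq> []" using less.prems(1) by (rule linked_nonempty)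
  have fin: "f \<in> set (allocs k)" using ne by (simp add: f_def)
  have f1: "1 \<le> f" using less.prems(2) fin by auto
  have fa: "f \<le> a" using fin unfolding a_def by (simp add: member_le_sum_list)
  show ?case
  proof (cases ks)
    case Nil
    then have "region k \<le> a" using less.prems fa by (auto simp: f_def)
    moreover have "2 * c * 1 \<le> 2 * c * a" using f1 fa by (intro mult_le_mono2) linarith
    ultimately show ?thesis using Nil by (simp add: a_def[symmetric] algebra_simps)
  next
    case (Cons k' ks')
    define B where "B = sum_list (concat (map allocs ks))"
    define R where "R = (\<Sum>k \<leftarrow> ks. region k + c)"
    have IH: "R + 2 * region k' + c \<le> (2 * c + 3) * B"
      using less.hyps[of ks' k'] less.prems Cons by (simp add: B_def R_def)
    have "region k \<le> f \<or> region k \<le> 2 * region k'"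
      using less.prems Cons by (auto simp: f_def)
    then show ?thesis
    proof
      \<comment> \<open>Here the allocations in \<open>k\<close> pay for its region. The induction
        hypothesis already covers \<open>c\<close> for a cached stacklet, so \<open>k\<close> adds
        three regions but only one further \<open>c\<close>.\<close>
      assume "region k \<le> f"
      moreover have "c \<le> c * a" using f1 fa by simp
      ultimately have "3 * region k + c \<le> (2 * c + 3) * a"
        unfolding distrib_right mult.assoc using fa by linarith
      moreover have eq: "(\<Sum>k \<leftarrow> k # ks. region k + c) = region k + c + R"
        "sum_list (concat (map allocs (k # ks))) = a + B"
        by (simp_all add: R_def a_def B_def)
      ultimately show ?thesis
        using IH unfolding eq distrib_left by linarith
    next
      assume le: "region k \<le> 2 * region k'"
      define a' where "a' = sum_list (allocs k')"
      define x where "x = a' + f"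
      have lk': "linked (k' # ks')" using less.prems Cons by simp
      have "last (allocs k') \<in> set (allocs k')" using linked_nonempty[OF lk'] by simp
      then have "1 \<le> last (allocs k')" "last (allocs k') \<le> a'"
        using less.prems(2) Cons unfolding a'_def by (auto simp: member_le_sum_list)
      then have x2: "2 \<le> x" using f1 by (simp add: x_def)
      have rx: "region k' + 1 \<le> x" using less.prems Cons by (auto simp: x_def a'_def f_def)
      \<comment> \<open>The factor \<open>2 * c + 3\<close> must reach the 7 below, which is where
        \<open>2 \<le> c\<close> enters. The excess \<open>d\<close> pays for metadata through
        \<open>2 \<le> x\<close>.\<close>
      obtain d where d: "c = d + 2" using assms(3) by (metis le_add_diff_inverse2)
      have dx: "d * 2 \<le> d * x" using x2 by (rule mult_le_mono2)
      \<comment> \<open>The regions of \<open>k'\<close>, of \<open>k\<close> and of a cached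
        stacklet come to at most 1 + 2 + 4 times \<open>region k'\<close>, and there are three
        metadata regions.\<close>
      have "7 * region k' + 3 * c \<le> 7 * x + 2 * (d * x)"
        using rx dx le0[of d] unfolding d distrib_left by linarith
      also have "\<dots> = (2 * c + 3) * x" unfolding d by (simp add: algebra_simps)
      finally have x_bound: "7 * region k' + 3 * c \<le> (2 * c + 3) * x" .
      have below: "(\<Sum>k \<leftarrow> ks'. region k + c) \<le> (2 * c + 3) * sum_list (concat (map allocs ks'))"
      proof (cases ks')
        case (Cons k'' ks'')
        then show ?thesis
          using less.hyps[of ks'' k''] less.prems \<open>ks = k' # ks'\<close> linked_tl[OF lk'] by simp
      qed simp
      have "(\<Sum>k \<leftarrow> k # ks. region k + c) + 2 * region k + c
        \<le> 7 * region k' + 3 * c + (\<Sum>k \<leftarrow> ks'. region k + c)"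
        using le Cons by simp
      also have "\<dots> \<le> (2 * c + 3) * (x + sum_list (concat (map allocs ks')))"
        using x_bound below by (simp add: algebra_simps)
      also have "\<dots> \<le> (2 * c + 3) * sum_list (concat (map allocs (k # ks)))"
        using fa Cons by (intro mult_le_mono2) (simp add: x_def a'_def a_def)
      finally show ?thesis .
    qed
  qed
qed

lemma segstack_memory_le:
  assumes "valid_stack s" "\<forall>m \<in> set (contents s). 1 \<le> m" "2 \<le> c"
  shows "segstack_memory c s \<le> (2 * c + 3) * sum_list (contents s)"
proof (cases "stacklets s")
  case Nil
  then have "cached s = None" using assms(1) by (cases "cached s") (auto simp: valid_stack_def)
  with Nil show ?thesis by (simp add: segstack_memory_def)
next
  case (Cons k ks)
  then have "(case cached s of None \<Rightarrow> 0 | Some r \<Rightarrow> r + c) \<le> 2 * region k + c"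
    using assms(1) by (auto simp: valid_stack_def split: option.split)
  with linked_memory[of k ks c] assms Cons show ?thesis
    by (simp add: segstack_memory_def valid_stack_def contents_def)
qed

section \<open>Paths in the program\<close>

lemma finite_children: "finite (children t)"
proof -
  \<comment> \<open>\<open>Join\<close> starts no task; \<open>t\<close> is a default value for
    it.\<close>
  have "children t \<subseteq> (\<lambda>i. case i of Fork u \<Rightarrow> u | Call u \<Rightarrow> u | Join \<Rightarrow> t) ` set (body t)"
    by (force simp: children_def)
  then show ?thesis by (rule finite_subset) simp
qed

lemma size_child:
  assumes "u \<in> children t"
  shows "size u < size t"
proof -
  obtain i where i: "i \<in> set (body t)" "size u < size i"
    using assms by (auto simp: children_def)
  have "size i \<le> size_list size (body t)"
    using i(1) by (rule size_list_estimation') simp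
  with i(2) show ?thesis by (cases t) simp
qed

text \<open>\<open>M1\<close> is a \<open>Max\<close>, which is meaningful only on a finite set.
  Children have smaller \<open>size\<close> than their parent, so by induction the tails of the
  paths range over finitely many lists.\<close>

lemma finite_dag_paths: "finite {ts. dag_path t ts}"
proof (induction "size t" arbitrary: t rule: less_induct)
  case less
  have "{ts. dag_path t ts} \<subseteq> insert [t] (\<Union>u \<in> children t. (#) t ` {ts. dag_path u ts})"
  proof
    fix ts assume "ts \<in> {ts. dag_path t ts}"
    then have d: "dag_path t ts" by simp
    then obtain us where ts: "ts = t # us" by (cases ts) (auto simp: dag_path_def)
    show "ts \<in> insert [t] (\<Union>u \<in> children t. (#) t ` {ts. dag_path u ts})"
      using d ts by (cases us) (auto simp: dag_path_def)
  qed
  moreover have "finite (\<Union>u \<in> children t. (#) t ` {ts. dag_path u ts})"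
    using less size_child finite_children by blast
  ultimately show ?case by (meson finite_insert finite_subset)
qed

lemma M1_ge:
  assumes "dag_path root ts"
  shows "sum_list (map frame_size ts) \<le> M1 root"
proof -
  have "{sum_list (map frame_size ts) | ts. dag_path root ts}
      = (\<lambda>ts. sum_list (map frame_size ts)) ` {ts. dag_path root ts}" by auto
  then show ?thesis
    unfolding M1_def using assms finite_dag_paths[of root] by (intro Max_ge) auto
qed

lemma sum_UN_le:
  fixes f :: "'a \<Rightarrow> nat"
  assumes "finite I" "\<And>i. i \<in> I \<Longrightarrow> finite (A i)"
  shows "sum f (\<Union>i\<in>I. A i) \<le> (\<Sum>i\<in>I. sum f (A i))"
  using assms
proof (induction I)
  case (insert i I)
  then have "sum f (A i \<union> (\<Union>i\<in>I. A i)) \<le> sum f (A i) + sum f (\<Union>i\<in>I. A i)"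
    by (subst sum_Un_nat) auto
  with insert show ?case by fastforce
qed simp

lemma sum_set_le_sum_list: "sum f (set xs) \<le> (\<Sum>x\<leftarrow>xs. f x)" for f :: "'a \<Rightarrow> nat"
  by (induction xs) (auto simp: sum.insert_if)

section \<open>Queues and stacks along the ancestors of a task\<close>

text \<open>These are the fields that \<open>run\<close> inspects; \<open>rest\<close> and
  \<open>at_join\<close> may change.\<close>

definition same_shape :: "frame \<Rightarrow> frame \<Rightarrow> bool" where
  "same_shape f f' \<longleftrightarrow> parent f' = parent f \<and> forked f' = forked f \<and> home f' = home f \<and> stolen f' = stolen f"

text \<open>
  If \<open>x\<close> is being executed, then \<open>run F x Q\<close> says that \<open>Q\<close>, the queue of its worker with the newest element
  first, consists of the parents of the forked tasks met when walking up from \<open>x\<close>. The walk ends at a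
  task whose continuation has been stolen. An ancestor in the queue may carry \<open>stolen\<close> from an earlier
  theft; the worker then runs its children on a stack other than its home.
\<close>

inductive run :: "(nat \<rightharpoonup> frame) \<Rightarrow> nat \<Rightarrow> nat list \<Rightarrow> bool" for F where
  thief: "F x = Some f \<Longrightarrow> stolen f \<Longrightarrow> run F x []"
| root: "F x = Some f \<Longrightarrow> \<not> stolen f \<Longrightarrow> parent f = None \<Longrightarrow> run F x []"
| called: "F x = Some f \<Longrightarrow> \<not> stolen f \<Longrightarrow> parent f = Some p \<Longrightarrow> \<not> forked f \<Longrightarrow> run F p Q \<Longrightarrow> run F x Q"
| detached: "F x = Some f \<Longrightarrow> \<not> stolen f \<Longrightarrow> parent f = Some p \<Longrightarrow> forked f \<Longrightarrow>
    F p = Some fp \<Longrightarrow> stolen fp \<Longrightarrow> run F x []"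
| queued: "F x = Some f \<Longrightarrow> \<not> stolen f \<Longrightarrow> parent f = Some p \<Longrightarrow> forked f \<Longrightarrow>
    F p = Some fp \<Longrightarrow> (stolen fp \<longrightarrow> home f \<noteq> home fp) \<Longrightarrow> run F p Q \<Longrightarrow> run F x (p # Q)"

text \<open>A walk sees only tasks reached by following parents, so agreement on a set
  \<open>D\<close> closed under \<open>parent\<close> suffices. In the uses \<open>D\<close> is
  everything, or leaves out tasks that have no live child in \<open>D\<close>.\<close>

lemma run_cong:
  assumes "run F x Q" "x \<in> D" "\<And>y f p. y \<in> D \<Longrightarrow> F y = Some f \<Longrightarrow> parent f = Some p \<Longrightarrow> p \<in> D"
    "\<And>y f. y \<in> D \<Longrightarrow> F y = Some f \<Longrightarrow> \<exists>f'. F' y = Some f' \<and> same_shape f f'"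
  shows "run F' x Q"
  using assms(1,2)
proof (induction rule: run.induct)
  case (thief x f)
  with assms(4)[of x f] show ?case by (auto simp: same_shape_def intro: run.thief)
next
  case (root x f)
  with assms(4)[of x f] show ?case by (auto simp: same_shape_def intro: run.root)
next
  case (called x f p Q)
  then obtain f' where f': "F' x = Some f'" "same_shape f f'" using assms(4) by blast
  have "run F' p Q" using called assms(3) by blast
  with f' called(2,3,4) show ?case by (intro run.called[of F' x f' p]) (simp_all add: same_shape_def)
next
  case (detached x f p fp)
  then have "p \<in> D" using assms(3) by blast
  with detached obtain f' fp' where f': "F' x = Some f'" "same_shape f f'" "F' p = Some fp'"
    "same_shape fp fp'"
    using assms(4) by meson
  with detached(2,3,4,6) show ?case
    by (intro run.detached[of F' x f' p fp']) (simp_all add: same_shape_def)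
next
  case (queued x f p fp Q)
  then have "p \<in> D" using assms(3) by blast
  with queued obtain f' fp' where f': "F' x = Some f'" "same_shape f f'" "F' p = Some fp'"
    "same_shape fp fp'"
    using assms(4) by meson
  have "run F' p Q" using queued \<open>p \<in> D\<close> by blast
  with f' queued(2,3,4,6) show ?case
    by (intro run.queued[of F' x f' p fp']) (simp_all add: same_shape_def)
qed

text \<open>Since \<open>p\<close> has only forked children and is not in \<open>Q\<close>, a walk
  can reach \<open>p\<close> only as the parent of a \<open>detached\<close> task, when
  \<open>p\<close> was stolen already and the walk stops anyway. A walk starting at \<open>p\<close>
  has an empty queue and now stops at once.\<close>

lemma run_steal_other:
  assumes "run F x Q" "F p = Some f" "\<And>y g. F y = Some g \<Longrightarrow> parent g = Some p \<Longrightarrow> forked g"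
    "p \<notin> set Q" "x = p \<longrightarrow> Q = []"
  shows "run (F(p \<mapsto> f\<lparr>stolen := True\<rparr>)) x Q"
  using assms(1,4,5)
proof (induction rule: run.induct)
  case (thief x g)
  then show ?case by (intro run.thief[where f = "if x = p then f\<lparr>stolen := True\<rparr> else g"]) auto
next
  case (root x g)
  then show ?case by (cases "x = p") (auto intro: run.thief run.root)
next
  case (called x g p' Q)
  then have "p' \<noteq> p" using assms(3)[of x g] by auto
  with called.IH called.prems have IH: "run (F(p \<mapsto> f\<lparr>stolen := True\<rparr>)) p' Q" by blast
  show ?case
  proof (cases "x = p")
    case True
    with called show ?thesis by (auto intro: run.thief)
  next
    case False
    then show ?thesis by (intro run.called[OF _ called(2,3,4) IH]) (use called(1) in simp)
  qed
next
  case (detached x g p' fp)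
  then show ?case
    by (cases "x = p"; cases "p' = p") (auto intro: run.thief run.detached)
next
  case (queued x g p' fp Q)
  then have ne: "p' \<noteq> p" "p \<notin> set Q" "x \<noteq> p" by auto
  with queued.IH have IH: "run (F(p \<mapsto> f\<lparr>stolen := True\<rparr>)) p' Q" by blast
  show ?case by (rule run.queued[OF _ queued(2,3,4) _ _ IH]) (use queued(1,5,6) ne in simp_all)
qed

text \<open>The oldest entry is the last one the walk meets. The theft cuts the walk at the forked
  child of \<open>p\<close>, which becomes \<open>detached\<close>, and the part cut off, the old
  walk from \<open>p\<close>, collects nothing.\<close>

lemma run_steal_oldest:
  assumes "run F x (Q @ [p])" "F p = Some f" "\<And>y g. F y = Some g \<Longrightarrow> parent g = Some p \<Longrightarrow> forked g"
    "p \<notin> set Q" "x \<noteq> p"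
  shows "run (F(p \<mapsto> f\<lparr>stolen := True\<rparr>)) x Q \<and> run F p []"
  using assms(1,4,5)
proof (induction x "Q @ [p]" arbitrary: Q rule: run.induct)
  case (called x g p')
  then have "p' \<noteq> p" using assms(3)[of x g] by auto
  with called have IH: "run (F(p \<mapsto> f\<lparr>stolen := True\<rparr>)) p' Q" "run F p []" by auto
  have "run (F(p \<mapsto> f\<lparr>stolen := True\<rparr>)) x Q"
    by (rule run.called[OF _ called(2,3,4) IH(1)]) (use called in auto)
  with IH(2) show ?case by simp
next
  case (queued x g p' fp Q')
  show ?case
  proof (cases Q)
    case Nil
    with queued show ?thesis by (auto intro: run.detached)
  next
    case (Cons a R)
    with queued have *: "a = p'" "Q' = R @ [p]" "p' \<noteq> p" "p \<notin> set R" by auto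
    with queued have IH: "run (F(p \<mapsto> f\<lparr>stolen := True\<rparr>)) p' R" "run F p []" by auto
    have "run (F(p \<mapsto> f\<lparr>stolen := True\<rparr>)) x (p' # R)"
      by (rule run.queued[OF _ queued(2,3,4) _ _ IH(1)]) (use queued * in auto)
    with IH(2) Cons * show ?thesis by simp
  qed
qed auto

lemma run_queued_child:
  assumes "run F x Q" "p \<in> set Q"
  shows "\<exists>y f. F y = Some f \<and> forked f \<and> parent f = Some p"
  using assms by (induction rule: run.induct) auto

text \<open>
  Only a stolen task runs its children on a stack that does not contain its own frame.
\<close>

fun nested :: "(nat \<rightharpoonup> frame) \<Rightarrow> nat list \<Rightarrow> bool" where
  "nested F [] \<longleftrightarrow> True"
| "nested F [x] \<longleftrightarrow> (\<forall>f p fp. F x = Some f \<longrightarrow> parent f = Some p \<longrightarrow> F p = Some fp \<longrightarrow> stolen fp)"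
| "nested F (x # y # S) \<longleftrightarrow> (\<forall>f. F x = Some f \<longrightarrow> parent f = Some y) \<and> nested F (y # S)"

lemma nested_tl: "nested F (x # S) \<Longrightarrow> nested F S"
  by (cases S) auto

text \<open>The bottom frame also constrains a task outside the list, namely its parent. That parent
  may become stolen or disappear, but it must not lose the flag.\<close>

lemma nested_cong:
  assumes "nested F S"
    "\<And>x f'. x \<in> set S \<Longrightarrow> F' x = Some f' \<Longrightarrow> \<exists>f. F x = Some f \<and> parent f' = parent f"
    "\<And>x f p fp'. x \<in> set S \<Longrightarrow> F x = Some f \<Longrightarrow> parent f = Some p \<Longrightarrow> F' p = Some fp' \<Longrightarrow>
      \<exists>fp. F p = Some fp \<and> (stolen fp \<longrightarrow> stolen fp')"
  shows "nested F' S"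
  using assms
proof (induction F S rule: nested.induct)
  case (2 F x)
  show ?case
  proof (simp, intro allI impI)
    fix f' p fp' assume a: "F' x = Some f'" "parent f' = Some p" "F' p = Some fp'"
    with 2(2)[of x f'] obtain f where f: "F x = Some f" "parent f = Some p" by auto
    with 2(3)[of x f p fp'] a obtain fp where "F p = Some fp" "stolen fp \<longrightarrow> stolen fp'" by auto
    with 2(1) f show "stolen fp'" by auto
  qed
next
  case (3 F x y S)
  have "nested F' (y # S)"
  proof (rule 3(1))
    show "nested F (y # S)" using 3(2) by simp
    show "\<exists>f. F z = Some f \<and> parent f' = parent f" if "z \<in> set (y # S)" "F' z = Some f'" for z f'
      using 3(3)[of z f'] that by simp
    show "\<exists>fp. F p = Some fp \<and> (stolen fp \<longrightarrow> stolen fp')"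
      if "z \<in> set (y # S)" "F z = Some f" "parent f = Some p" "F' p = Some fp'" for z f p fp'
      using 3(4)[of z f p fp'] that by simp
  qed
  moreover have "parent f' = Some y" if "F' x = Some f'" for f'
    using 3(2) 3(3)[of x f'] that by auto
  ultimately show ?case by simp
qed simp

lemma nested_child_above:
  assumes "nested F (A @ y # x # B)" "F y = Some f"
  shows "parent f = Some x"
  using assms
proof (induction A)
  case (Cons a A)
  then show ?case by (cases A) auto
qed simp

section \<open>The invariant\<close>

text \<open>
  \<open>lineage t\<close> lists the identifiers from \<open>t\<close> up to the root; it also witnesses that \<open>parent\<close> is acyclic.
\<close>

locale tree =
  fixes root :: task and F :: "nat \<rightharpoonup> frame" and task_of :: "nat \<Rightarrow> task" and lineage :: "nat \<Rightarrow> nat list"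
  assumes finite_frames: "finite (dom F)"
    and task_of_mem: "F t = Some f \<Longrightarrow> task_of t \<in> tasks_of root"
    and rest_suffix: "F t = Some f \<Longrightarrow> \<exists>as. body (task_of t) = as @ rest f"
    and no_parent: "F t = Some f \<Longrightarrow> parent f = None \<Longrightarrow> task_of t = root \<and> lineage t = [t]"
    and parent: "F t = Some f \<Longrightarrow> parent f = Some p \<Longrightarrow>
      (\<exists>fp. F p = Some fp) \<and> task_of t \<in> children (task_of p) \<and> lineage t = t # lineage p"
begin

lemma parent_neq: "F t = Some f \<Longrightarrow> parent f = Some p \<Longrightarrow> p \<noteq> t"
  using parent by fastforce

lemma tree_update:
  assumes "F t = Some f" "parent f' = parent f" "rest f = as @ rest f'"
  shows "tree root (F(t \<mapsto> f')) task_of lineage"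
proof
  show "finite (dom (F(t \<mapsto> f')))" using finite_frames by simp
qed (use assms task_of_mem rest_suffix[of t f] rest_suffix no_parent parent in \<open>fastforce split: if_splits\<close>)+

lemma tree_insert:
  assumes "F p = Some fp" "F n = None" "parent f' = Some p" "rest f' = body u"
    "u \<in> children (task_of p)"
  shows "tree root (F(n \<mapsto> f')) (task_of(n := u)) (lineage(n := n # lineage p))"
proof
  show "finite (dom (F(n \<mapsto> f')))" using finite_frames by simp
  have pn: "p \<noteq> n" using assms by auto
  have u: "u \<in> tasks_of root" using tasks_of.child[OF task_of_mem[OF assms(1)] assms(5)] .
  fix t f assume t: "(F(n \<mapsto> f')) t = Some f"
  show "(task_of(n := u)) t \<in> tasks_of root" using t u task_of_mem by (auto split: if_splits)
  show "\<exists>as. body ((task_of(n := u)) t) = as @ rest f"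
    using t rest_suffix assms(4) by (auto split: if_splits)
  show "(task_of(n := u)) t = root \<and> (lineage(n := n # lineage p)) t = [t]" if "parent f = None"
    using t that assms no_parent by (auto split: if_splits)
  show "(\<exists>fp. (F(n \<mapsto> f')) p' = Some fp) \<and> (task_of(n := u)) t \<in> children ((task_of(n := u)) p') \<and>
     (lineage(n := n # lineage p)) t = t # (lineage(n := n # lineage p)) p'" if "parent f = Some p'" for p'
    using t that assms pn parent[of t f p'] by (auto split: if_splits)
qed

lemma tree_remove:
  assumes "\<And>x f. F x = Some f \<Longrightarrow> parent f \<noteq> Some t"
  shows "tree root (F(t := None)) task_of lineage"
proof
  show "finite (dom (F(t := None)))" using finite_frames by simp
qed (use assms task_of_mem rest_suffix no_parent parent in \<open>fastforce split: if_splits\<close>)+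

end

text \<open>
  \<open>on g\<close> lists the tasks whose frames are on stack \<open>g\<close>, the top one first.
\<close>

locale store =
  fixes F :: "nat \<rightharpoonup> frame" and sts :: "segstack list" and task_of :: "nat \<Rightarrow> task" and
    on :: "nat \<Rightarrow> nat list"
  assumes on_iff: "x \<in> set (on g) \<longleftrightarrow> (\<exists>f. F x = Some f \<and> home f = g)"
    and on_distinct: "distinct (on g)"
    and on_nested: "nested F (on g)"
    and called_off_home: "F x = Some f \<Longrightarrow> parent f = Some p \<Longrightarrow> F p = Some fp \<Longrightarrow> stolen fp \<Longrightarrow>
      \<not> forked f \<Longrightarrow> home f \<noteq> home fp"
    and stack_contents: "g < length sts \<Longrightarrow>
      valid_stack (sts ! g) \<and> contents (sts ! g) = map (\<lambda>x. frame_size (task_of x)) (on g)"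
    and on_beyond: "length sts \<le> g \<Longrightarrow> on g = []"
begin

text \<open>Clearing \<open>stolen\<close> has to wait until \<open>t\<close> has no child, because
  a child at the bottom of a stack relies on the flag. Setting it requires that there be no called
  child, which might lie on the same stack, against \<open>called_off_home\<close>.\<close>

lemma store_update:
  assumes "F t = Some f" "parent f' = parent f" "home f' = home f" "forked f' = forked f"
    "stolen f \<Longrightarrow> stolen f' \<or> (\<forall>x g. F x = Some g \<longrightarrow> parent g \<noteq> Some t)"
    "stolen f' \<Longrightarrow> stolen f \<or> (\<forall>x g. F x = Some g \<longrightarrow> parent g = Some t \<longrightarrow> forked g)"
  shows "store (F(t \<mapsto> f')) sts task_of on"
proof
  show "x \<in> set (on g) \<longleftrightarrow> (\<exists>h. (F(t \<mapsto> f')) x = Some h \<and> home h = g)" for x g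
    using assms(1,3) on_iff by auto
  show "nested (F(t \<mapsto> f')) (on g)" for g
    by (rule nested_cong[OF on_nested]) (use assms in \<open>auto split: if_splits\<close>)
  show "home g \<noteq> home fp" if "(F(t \<mapsto> f')) x = Some g" "parent g = Some p" "(F(t \<mapsto> f')) p = Some fp"
    "stolen fp"
      "\<not> forked g" for x g p fp
    using that assms called_off_home[of x "if x = t then f else g" p "if p = t then f else fp"]
    by (auto split: if_splits)
qed (use on_distinct stack_contents on_beyond in auto)

lemma store_push:
  assumes "F n = None" "F p = Some fp" "parent f = Some p" "home f = g" "g < length sts"
    "if stolen fp then on g = [] else \<exists>S. on g = p # S"
    "\<And>x f. F x = Some f \<Longrightarrow> parent f \<noteq> Some n"
  shows "store (F(n \<mapsto> f)) (sts[g := alloc (frame_size u) (sts ! g)]) (task_of(n := u)) (on(g := n # on g))"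
proof
  have n: "n \<notin> set (on g')" for g' using assms(1) on_iff by auto
  have pn: "p \<noteq> n" using assms by auto
  show "x \<in> set ((on(g := n # on g)) g') \<longleftrightarrow> (\<exists>h. (F(n \<mapsto> f)) x = Some h \<and> home h = g')" for x g'
    using assms(1,4) on_iff by auto
  show "distinct ((on(g := n # on g)) g')" for g' using on_distinct n by auto
  have old: "nested (F(n \<mapsto> f)) (on g')" for g'
    by (rule nested_cong[OF on_nested]) (use assms n in \<open>auto split: if_splits\<close>)
  have "nested (F(n \<mapsto> f)) (n # on g)"
  proof (cases "on g")
    case (Cons q S)
    then have "q = p" using assms(6) by (simp split: if_splits)
    with old[of g] Cons assms(3) show ?thesis by simp
  qed (use assms pn in \<open>auto split: if_splits\<close>)
  with old show "nested (F(n \<mapsto> f)) ((on(g := n # on g)) g')" for g' by simp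
  show "home h \<noteq> home fq" if "(F(n \<mapsto> f)) x = Some h" "parent h = Some q" "(F(n \<mapsto> f)) q = Some fq"
    "stolen fq"
      "\<not> forked h" for x h q fq
  proof (cases "x = n")
    case True
    then have "p \<in> set (on (home fp))" "h = f" "q = p" "fq = fp"
      using on_iff assms that pn by auto
    then show ?thesis using assms that by (auto split: if_splits)
  next
    case False
    then have "q \<noteq> n" using that assms(7)[of x h] by auto
    with False show ?thesis using called_off_home[of x h q fq] that by auto
  qed
  show "valid_stack (sts[g := alloc (frame_size u) (sts ! g)] ! g') \<and>
      contents (sts[g := alloc (frame_size u) (sts ! g)] ! g') =
      map (\<lambda>x. frame_size ((task_of(n := u)) x)) ((on(g := n # on g)) g')"
    if "g' < length (sts[g := alloc (frame_size u) (sts ! g)])" for g'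
    using that stack_contents[of g'] n[of g']
    by (auto simp: nth_list_update valid_stack_alloc contents_alloc)
  show "(on(g := n # on g)) g' = []" if "length (sts[g := alloc (frame_size u) (sts ! g)]) \<le> g'"
    for g'
    using that assms on_beyond by auto
qed

lemma store_pop:
  assumes "on g = t # S" "dealloc (sts ! g) s" "\<And>x f. F x = Some f \<Longrightarrow> parent f \<noteq> Some t"
  shows "store (F(t := None)) (sts[g := s]) task_of (on(g := S))"
proof
  obtain f where f: "F t = Some f" "home f = g" using on_iff[of t g] assms(1) by auto
  have g: "g < length sts" using on_beyond[of g] assms(1) by (cases "g < length sts") auto
  have tS: "t \<notin> set S" using on_distinct[of g] assms(1) by auto
  show "x \<in> set ((on(g := S)) g') \<longleftrightarrow> (\<exists>h. (F(t := None)) x = Some h \<and> home h = g')" for x g'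
    using f tS on_iff[of x g'] assms(1) by auto
  show "distinct ((on(g := S)) g')" for g' using on_distinct[of g'] assms(1) by auto
  have "nested F ((on(g := S)) g')" for g' using on_nested[of g'] assms(1) by (auto dest: nested_tl)
  then show "nested (F(t := None)) ((on(g := S)) g')" for g'
    by (rule nested_cong) (use assms in \<open>auto split: if_splits\<close>)
  show "home h \<noteq> home fq" if "(F(t := None)) x = Some h" "parent h = Some q"
    "(F(t := None)) q = Some fq" "stolen fq"
      "\<not> forked h" for x h q fq
    using that called_off_home[of x h q fq] by (auto split: if_splits)
  show "valid_stack (sts[g := s] ! g') \<and> contents (sts[g := s] ! g') =
      map (\<lambda>x. frame_size (task_of x)) ((on(g := S)) g')" if "g' < length (sts[g := s])" for g'
    using that stack_contents[of g'] dealloc_valid[OF assms(2)] assms(1)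
      by (auto simp: nth_list_update)
  show "(on(g := S)) g' = []" if "length (sts[g := s]) \<le> g'" for g'
    using that g on_beyond by auto
qed

lemma store_new_stack: "store F (sts @ [empty_stack]) task_of on"
proof
  fix g assume "g < length (sts @ [empty_stack])"
  then show "valid_stack ((sts @ [empty_stack]) ! g) \<and>
      contents ((sts @ [empty_stack]) ! g) = map (\<lambda>x. frame_size (task_of x)) (on g)"
    using stack_contents[of g] on_beyond[of g] valid_empty_stack
    by (cases "g < length sts") (auto simp: nth_append)
qed (use on_iff on_distinct on_nested called_off_home on_beyond in auto)

text \<open>By \<open>nested\<close>, a frame directly above \<open>t\<close> would belong to a
  child of \<open>t\<close>. Hence a worker that moves to the home of a childless task finds its
  frame on top.\<close>

lemma top_of_home:
  assumes "F t = Some f" "\<And>x g. F x = Some g \<Longrightarrow> parent g \<noteq> Some t"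
  shows "\<exists>S. on (home f) = t # S"
proof -
  have "t \<in> set (on (home f))" using on_iff assms(1) by auto
  then obtain A B where AB: "on (home f) = A @ t # B" by (meson split_list)
  show ?thesis
  proof (cases A rule: rev_cases)
    case (snoc A' y)
    then have "y \<in> set (on (home f))" using AB by simp
    then obtain g where "F y = Some g" using on_iff by auto
    then have "parent g = Some t" using nested_child_above[of F A' y t B g] on_nested[of "home f"] AB snoc by simp
    with assms(2) \<open>F y = Some g\<close> show ?thesis by auto
  qed (use AB in auto)
qed

end

text \<open>
  Having \<open>place\<close> as a function makes the ways in which a live task can be suspended mutually exclusive.
\<close>

datatype place = Running nat | Queued nat | Calling nat | Waiting

text \<open>\<open>stolen_chain\<close> prepares for the moment when a join clears the flag: the
  joining worker has an empty queue, so the walk, which then goes on to the parent, must collect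
  nothing there. \<open>join_ahead\<close> carries strictness along the execution.
  \<open>unstolen_child\<close> holds because an unstolen task is resumed only after its child has
  returned.\<close>

locale sched =
  fixes P :: nat and F :: "nat \<rightharpoonup> frame" and cur :: "nat \<Rightarrow> nat option" and queue :: "nat \<Rightarrow> nat list" and
    place :: "nat \<Rightarrow> place"
  assumes cur_iff: "cur w = Some t \<longleftrightarrow> t \<in> dom F \<and> place t = Running w"
    and cur_bound: "cur w = Some t \<Longrightarrow> w < P"
    and queue_iff: "t \<in> set (queue v) \<longleftrightarrow> t \<in> dom F \<and> place t = Queued v"
    and queue_distinct: "distinct (queue v)"
    and calling_iff: "(\<exists>g. F x = Some g \<and> \<not> forked g \<and> parent g = Some t) \<longleftrightarrow> t \<in> dom F \<and> place t = Calling x"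
    and waiting_iff: "F t = Some f \<Longrightarrow> at_join f \<longleftrightarrow> place t = Waiting"
    and waiting: "F t = Some f \<Longrightarrow> place t = Waiting \<Longrightarrow>
      stolen f \<and> (\<exists>x g. F x = Some g \<and> forked g \<and> parent g = Some t)"
    and unstolen_child: "F t = Some f \<Longrightarrow> \<not> stolen f \<Longrightarrow> F x = Some g \<Longrightarrow> forked g \<Longrightarrow> parent g = Some t \<Longrightarrow>
      (\<exists>v. place t = Queued v) \<and> (\<forall>y h. F y = Some h \<longrightarrow> forked h \<longrightarrow> parent h = Some t \<longrightarrow> y = x)"
    and join_ahead: "F t = Some f \<Longrightarrow> place t \<noteq> Waiting \<Longrightarrow> stolen f \<or> (\<exists>v. place t = Queued v) \<Longrightarrow>
      Join \<in> set (rest f)"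
    and cur_chain: "cur w = Some t \<Longrightarrow> run F t (rev (queue w))"
    and idle_queue: "cur w = None \<Longrightarrow> queue w = []"
    and stolen_chain: "F t = Some f \<Longrightarrow> stolen f \<Longrightarrow> parent f = Some p \<Longrightarrow>
      if forked f then \<exists>fp. F p = Some fp \<and> stolen fp else run F p []"

text \<open>Injectivity keeps the allocations of one worker off the stacks of the others. It is
  restricted to workers below \<open>P\<close> because \<open>own v = v\<close> persists for the
  other numbers and may coincide with the index of a stack created later.\<close>

locale workers =
  fixes P :: nat and F :: "nat \<rightharpoonup> frame" and sts :: "segstack list" and on :: "nat \<Rightarrow> nat list" and
    cur :: "nat \<Rightarrow> nat option" and own :: "nat \<Rightarrow> nat"
  assumes own_inj: "inj_on own {..<P}"
    and own_bound: "w < P \<Longrightarrow> own w < length sts"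
    and own_top: "w < P \<Longrightarrow> case cur w of None \<Rightarrow> on (own w) = []
      | Some t \<Rightarrow> (\<exists>f. F t = Some f \<and> (if stolen f then on (own w) = [] else (\<exists>S. on (own w) = t # S)))"

locale inv = tree root F task_of lineage + store F sts task_of on + sched P F cur queue place +
    workers P F sts on cur own
  for P root F sts cur own queue task_of lineage on place +
  assumes strict: "fully_strict root"
begin

section \<open>Consequences of the invariant for a running task\<close>

lemma child_of_rest: "F t = Some f \<Longrightarrow> rest f = i # r \<Longrightarrow> i = Fork u \<or> i = Call u \<Longrightarrow> u \<in> children (task_of t)"
  using rest_suffix[of t f] by (auto simp: children_def)

text \<open>Strictness of the program enters the argument here. It yields \<open>join_ahead\<close>
  for a task that goes into a queue.\<close>

lemma join_after_fork:
  assumes "F t = Some f" "rest f = Fork u # r"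
  shows "Join \<in> set r"
proof -
  obtain as where as: "body (task_of t) = as @ Fork u # r" using rest_suffix assms by metis
  then have "\<exists>j > length as. j < length (body (task_of t)) \<and> body (task_of t) ! j = Join"
    using strict task_of_mem[OF assms(1)] unfolding fully_strict_def by force
  then obtain j where j: "j > length as" "j < length (body (task_of t))"
    "body (task_of t) ! j = Join" by blast
  then obtain k where "j = length as + Suc k" using less_imp_Suc_add by fastforce
  with j as show ?thesis by (force simp: nth_append in_set_conv_nth)
qed

text \<open>A forked child would put \<open>t\<close> into a queue and a called child would make it
  a caller, but \<open>place\<close> is a function. So the frame of a finished task can be removed
  without leaving orphans.\<close>

lemma running_childless:
  assumes "cur w = Some t" "F t = Some f" "\<not> stolen f" "F x = Some g"
  shows "parent g \<noteq> Some t"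
proof
  assume "parent g = Some t"
  moreover have "place t = Running w" using assms(1) cur_iff by blast
  ultimately show False
    using assms unstolen_child[of t f x g] calling_iff[of x t] by (cases "forked g") auto
qed

text \<open>A running stolen task has a \<open>Join\<close> ahead of it by
  \<open>join_ahead\<close>, and an empty \<open>rest\<close> contains none.\<close>

lemma finished_unstolen:
  assumes "cur w = Some t" "F t = Some f" "rest f = []"
  shows "\<not> stolen f"
  using assms cur_iff[of w t] join_ahead[of t f] by auto

lemma own_eq_home:
  assumes "cur w = Some t" "F t = Some f"
  shows "own w = home f \<longleftrightarrow> \<not> stolen f"
proof -
  have "t \<in> set (on (own w)) \<longleftrightarrow> own w = home f" using on_iff assms(2) by auto
  then show ?thesis using own_top[OF cur_bound[OF assms(1)]] assms by (auto split: if_splits)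
qed

lemma stolen_queue:
  assumes "cur w = Some t" "F t = Some f" "stolen f"
  shows "queue w = []"
  using cur_chain[OF assms(1)] assms(2,3) by (cases rule: run.cases) auto

section \<open>The scheduling state after each kind of step\<close>

lemma sched_start:
  assumes t: "cur w = Some t" "F t = Some f" and r: "rest f = i # r"
    and i: "if frk then i = Fork u else i = Call u" and n: "F n = None"
  shows "sched P (F(t \<mapsto> f\<lparr>rest := r\<rparr>, n \<mapsto> \<lparr>parent = Some t, forked = frk, home = own w, rest = b,
      stolen = False, at_join = False\<rparr>)) (cur(w := Some n))
      (queue(w := queue w @ (if frk then [t] else [])))
      (place(t := if frk then Queued w else Calling n, n := Running w))"
    (is "sched P ?F ?cur ?queue ?place")
proof -
  have nt: "n \<noteq> t" using t n by auto
  have pt: "place t = Running w" using t cur_iff by auto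
  have nop: "parent g \<noteq> Some n" if "F x = Some g" for x g using parent that n by fastforce
  have chain: "run ?F x Q" if "run F x Q" for x Q
    by (rule run_cong[OF that, of UNIV]) (use t n in \<open>auto simp: same_shape_def\<close>)
  \<comment> \<open>The goals follow the assumptions of \<open>sched\<close>, here and in the lemmas
    below: 1 \<open>cur_iff\<close>, 2 \<open>cur_bound\<close>, 3 \<open>queue_iff\<close>, 4
    \<open>queue_distinct\<close>, 5 \<open>calling_iff\<close>, 6 \<open>waiting_iff\<close>, 7
    \<open>waiting\<close>, 8 \<open>unstolen_child\<close>, 9 \<open>join_ahead\<close>, 10
    \<open>cur_chain\<close>, 11 \<open>idle_queue\<close>, 12 \<open>stolen_chain\<close>.\<close>
  show ?thesis
  proof (rule sched.intro, goal_cases)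
    case (1 v x)
    then show ?case using cur_iff[of v x] cur_iff[of w t] t nt n by auto
  next
    case (2 v x)
    then show ?case using cur_bound t by (auto split: if_splits)
  next
    case (3 x v)
    then show ?case using queue_iff[of x v] queue_iff[of n v] pt nt n t by auto
  next
    case (4 v)
    then show ?case using queue_distinct queue_iff[of t w] pt by auto
  next
    case (5 x y)
    then show ?case using calling_iff[of x y] calling_iff[of x t] pt nt n nop t
      by (cases "x = t"; cases "x = n"; cases "y = n"; cases "y = t") auto
  next
    case (6 x g)
    then show ?case using waiting_iff[of x g] waiting_iff[of t f] pt nt t by (auto split: if_splits)
  next
    case (7 x g)
    then have x: "x \<noteq> t" "x \<noteq> n" by (auto split: if_splits)
    with 7 obtain y h where "stolen g" "F y = Some h" "forked h" "parent h = Some x"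
      using waiting[of x g] by auto
    then have "\<exists>y h. ?F y = Some h \<and> forked h \<and> parent h = Some x"
      using n t(2) by (intro exI[of _ y] exI[of _ "if y = t then f\<lparr>rest := r\<rparr> else h"]) auto
    with \<open>stolen g\<close> show ?case by simp
  next
    case (8 x g y h)
    have old: "\<exists>h. F y = Some h \<and> forked h \<and> parent h = Some x"
      if "y \<noteq> n" "?F y = Some h" "forked h" "parent h = Some x" for y h
      using that t(2) by (auto split: if_splits)
    have xn: "x \<noteq> n" using 8(3,5) nop nt t(2) by (auto split: if_splits)
    show ?case
    proof (cases "x = t")
      case True
      have only: "y = n \<and> frk" if "?F y = Some h" "forked h" "parent h = Some x" for y h
      proof (cases "y = n")
        case False
        with old[OF _ that] running_childless[OF t] 8(1,2) True nt show ?thesis by auto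
      qed (use that in auto)
      show ?thesis
      proof (intro conjI allI impI)
        show "\<exists>v. ?place x = Queued v" using only[OF 8(3-5)] True nt by simp
        show "z = y" if "?F z = Some k" "forked k" "parent k = Some x" for z k
          using only[OF 8(3-5)] only[OF that] by simp
      qed
    next
      case False
      with xn 8(1,2) have g: "F x = Some g" "\<not> stolen g" by auto
      have yn: "z \<noteq> n" if "?F z = Some h" "parent h = Some x" for z h using that False by auto
      have old': "\<exists>h. F z = Some h \<and> forked h \<and> parent h = Some x"
        if "?F z = Some h" "forked h" "parent h = Some x" for z h
        using old[OF yn[OF that(1,3)] that] .
      obtain h' where h': "F y = Some h'" "forked h'" "parent h' = Some x"
        using old'[OF 8(3-5)] by blast
      show ?thesis
      proof (intro conjI allI impI)
        show "\<exists>v. ?place x = Queued v" using unstolen_child[OF g h'] False xn by simp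
        show "z = y" if "?F z = Some k" "forked k" "parent k = Some x" for z k
          using unstolen_child[OF g h'] old'[OF that] by blast
      qed
    qed
  next
    case (9 x g)
    then show ?case
    proof (cases "x = t")
      case True
      then show ?thesis using 9 t nt join_ahead[of t f] pt r i join_after_fork[of t f u r]
        by (auto split: if_splits)
    qed (use 9 join_ahead[of x g] in \<open>auto split: if_splits\<close>)
  next
    case (10 v x)
    show ?case
    proof (cases "v = w")
      case True
      have run: "run ?F t (rev (queue w))" by (rule chain[OF cur_chain[OF t(1)]])
      \<comment> \<open>If \<open>t\<close> still carries an earlier theft, its new child lives off
        the home of \<open>t\<close>, as the rule \<open>queued\<close> asks.\<close>
      have off: "stolen f \<longrightarrow> own w \<noteq> home f" using own_eq_home[OF t] by simp
      have "run ?F n (rev (queue w @ (if frk then [t] else [])))"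
      proof (cases frk)
        case True
        with nt run off show ?thesis by (auto intro!: run.queued)
      next
        case False
        with nt have "run ?F n (rev (queue w))" by (intro run.called[OF _ _ _ _ run]) auto
        with False show ?thesis by simp
      qed
      with True 10 show ?thesis by simp
    next
      case False
      with 10 show ?thesis using chain cur_chain by auto
    qed
  next
    case (11 v)
    then show ?case using idle_queue by (auto split: if_splits)
  next
    case (12 x g p)
    then have "x \<noteq> n" by auto
    with 12 t(2) obtain g' where g': "F x = Some g'" "stolen g'" "parent g' = Some p"
      "forked g' = forked g"
      by (auto split: if_splits)
    then have "p \<noteq> n" using nop by auto
    with stolen_chain[OF g'(1-3)] g'(4) chain t(2) show ?case by (auto split: if_splits)
  qed
qed

lemma sched_join_unstolen:
  assumes t: "cur w = Some t" "F t = Some f" "\<not> stolen f"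
  shows "sched P (F(t \<mapsto> f\<lparr>rest := r\<rparr>)) cur queue place"
    (is "sched P ?F _ _ _")
proof -
  have pt: "place t = Running w" using t cur_iff by auto
  have chain: "run ?F x Q" if "run F x Q" for x Q
    by (rule run_cong[OF that, of UNIV]) (use t in \<open>auto simp: same_shape_def\<close>)
  \<comment> \<open>\<open>Pr\<close> abstracts from the condition on the child, so that one
    equivalence serves both forked and called children.\<close>
  have kid_iff: "(\<exists>h. ?F y = Some h \<and> Pr (forked h) (parent h)) \<longleftrightarrow> (\<exists>h. F y = Some h \<and> Pr (forked h) (parent h))" for y Pr
    using t by auto
  show ?thesis
  proof (rule sched.intro, goal_cases)
    case (1 v x)
    then show ?case using cur_iff[of v x] t by auto
  next
    case (3 x v)
    then show ?case using queue_iff[of x v] t by auto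
  next
    case (5 x y)
    then show ?case using calling_iff[of x y] kid_iff[of x "\<lambda>a b. \<not> a \<and> b = Some y"] t by auto
  next
    case (6 x g)
    then show ?case using waiting_iff[of x g] waiting_iff[of t f] t by (auto split: if_splits)
  next
    case (7 x g)
    then show ?case using pt waiting[of x g] kid_iff[of _ "\<lambda>a b. a \<and> b = Some x"]
      by (auto split: if_splits)
  next
    case (8 x g y h)
    have old: "\<exists>h. F y = Some h \<and> forked h \<and> parent h = Some x"
      if "?F y = Some h" "forked h" "parent h = Some x" for y h
      using that kid_iff[of y "\<lambda>a b. a \<and> b = Some x"] by blast
    obtain g' h' where "F x = Some g'" "\<not> stolen g'" "F y = Some h'" "forked h'"
      "parent h' = Some x"
      using old[OF 8(3-5)] 8(1,2) t by (auto split: if_splits)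
    from unstolen_child[OF this] show ?case using old by blast
  next
    case (9 x g)
    then show ?case using t pt join_ahead[of x g] by (auto split: if_splits)
  next
    case (10 v x)
    then show ?case using chain cur_chain by auto
  next
    case (12 x g p)
    then obtain g' where g': "F x = Some g'" "stolen g'" "parent g' = Some p" "forked g' = forked g"
      using t by (auto split: if_splits)
    with stolen_chain[OF g'(1-3)] chain t show ?case by (auto split: if_splits)
  qed (use cur_bound queue_distinct idle_queue in auto)
qed

lemma sched_join_wait:
  assumes t: "cur w = Some t" "F t = Some f" "stolen f" and kid: "F y = Some k" "forked k"
    "parent k = Some t"
  shows "sched P (F(t \<mapsto> f\<lparr>rest := r, at_join := True\<rparr>)) (cur(w := None)) queue (place(t := Waiting))"
    (is "sched P ?F ?cur _ ?place")
proof -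
  have pt: "place t = Running w" using t cur_iff by auto
  have chain: "run ?F x Q" if "run F x Q" for x Q
    by (rule run_cong[OF that, of UNIV]) (use t in \<open>auto simp: same_shape_def\<close>)
  have kid_iff: "(\<exists>h. ?F y = Some h \<and> Pr (forked h) (parent h)) \<longleftrightarrow> (\<exists>h. F y = Some h \<and> Pr (forked h) (parent h))" for y Pr
    using t by auto
  show ?thesis
  proof (rule sched.intro, goal_cases)
    case (1 v x)
    then show ?case using cur_iff[of v x] cur_iff[of w x] t by auto
  next
    case (2 v x)
    then show ?case using cur_bound by (auto split: if_splits)
  next
    case (3 x v)
    then show ?case using queue_iff[of x v] pt t by auto
  next
    case (5 x y)
    then show ?case using calling_iff[of x y] kid_iff[of x "\<lambda>a b. \<not> a \<and> b = Some y"] pt t by auto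
  next
    case (6 x g)
    then show ?case using waiting_iff[of x g] t by (auto split: if_splits)
  next
    case (7 x g)
    have "\<exists>y h. F y = Some h \<and> forked h \<and> parent h = Some x" "stolen g"
      using 7 t kid waiting[of x g] by (auto split: if_splits)
    with kid_iff[of _ "\<lambda>a b. a \<and> b = Some x"] show ?case by blast
  next
    case (8 x g y h)
    have old: "\<exists>h. F y = Some h \<and> forked h \<and> parent h = Some x"
      if "?F y = Some h" "forked h" "parent h = Some x" for y h
      using that kid_iff[of y "\<lambda>a b. a \<and> b = Some x"] by blast
    obtain h' where "x \<noteq> t" "F x = Some g" "\<not> stolen g" "F y = Some h'" "forked h'"
      "parent h' = Some x"
      using old[OF 8(3-5)] 8(1,2) t by (auto split: if_splits)
    note uc = unstolen_child[OF this(2-6)]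
    show ?case
    proof (intro conjI allI impI)
      show "\<exists>v. ?place x = Queued v" using uc \<open>x \<noteq> t\<close> by simp
      show "z = y" if "?F z = Some k" "forked k" "parent k = Some x" for z k
        using uc old[OF that] by blast
    qed
  next
    case (9 x g)
    then show ?case using t pt join_ahead[of x g] by (auto split: if_splits)
  next
    case (10 v x)
    then show ?case using chain cur_chain by (auto split: if_splits)
  next
    \<comment> \<open>The worker goes idle with an empty queue because a walk from a stolen task
      collects nothing.\<close>
    case (11 v)
    then show ?case using idle_queue stolen_queue[OF t] by (auto split: if_splits)
  next
    case (12 x g p)
    then obtain g' where g': "F x = Some g'" "stolen g'" "parent g' = Some p" "forked g' = forked g"
      using t by (auto split: if_splits)
    with stolen_chain[OF g'(1-3)] chain t show ?case by (auto split: if_splits)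
  qed (use queue_distinct in auto)
qed

lemma sched_join_last:
  assumes t: "cur w = Some t" "F t = Some f" "stolen f"
    and no_kid: "\<And>y k. F y = Some k \<Longrightarrow> parent k \<noteq> Some t"
  shows "sched P (F(t \<mapsto> f\<lparr>rest := r, stolen := False\<rparr>)) cur queue place"
    (is "sched P ?F _ _ _")
proof -
  have pt: "place t = Running w" using t cur_iff by auto
  have chain: "run ?F x Q" if "run F x Q" "x \<noteq> t" for x Q
    by (rule run_cong[OF that(1), of "- {t}"]) (use t that no_kid in \<open>auto simp: same_shape_def\<close>)
  have kid_iff: "(\<exists>h. ?F y = Some h \<and> Pr (forked h) (parent h)) \<longleftrightarrow> (\<exists>h. F y = Some h \<and> Pr (forked h) (parent h))" for y Pr
    using t by auto
  show ?thesis
  proof (rule sched.intro, goal_cases)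
    case (1 v x)
    then show ?case using cur_iff[of v x] t by auto
  next
    case (3 x v)
    then show ?case using queue_iff[of x v] t by auto
  next
    case (5 x y)
    then show ?case using calling_iff[of x y] kid_iff[of x "\<lambda>a b. \<not> a \<and> b = Some y"] t by auto
  next
    case (6 x g)
    then show ?case using waiting_iff[of x g] waiting_iff[of t f] t by (auto split: if_splits)
  next
    case (7 x g)
    then show ?case using pt waiting[of x g] kid_iff[of _ "\<lambda>a b. a \<and> b = Some x"]
      by (auto split: if_splits)
  next
    case (8 x g y h)
    have old: "\<exists>h. F y = Some h \<and> forked h \<and> parent h = Some x"
      if "?F y = Some h" "forked h" "parent h = Some x" for y h
      using that kid_iff[of y "\<lambda>a b. a \<and> b = Some x"] by blast
    obtain h' where h': "F y = Some h'" "forked h'" "parent h' = Some x"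
      using old[OF 8(3-5)] by blast
    then have "F x = Some g" "\<not> stolen g" using no_kid[of y h'] 8(1,2) by (auto split: if_splits)
    from unstolen_child[OF this h'] show ?case using old by blast
  next
    case (9 x g)
    then show ?case using t pt join_ahead[of x g] by (auto split: if_splits)
  next
    case (10 v x)
    show ?case
    proof (cases "x = t")
      case True
      then have "v = w" using 10 t pt cur_iff by simp
      \<comment> \<open>With the flag cleared, the walk from \<open>t\<close> no longer stops at
        \<open>t\<close>. It remains empty by \<open>stolen_chain\<close>.\<close>
      have "run ?F t []"
      proof (cases "parent f")
        case None
        then show ?thesis by (intro run.root[of _ _ "f\<lparr>rest := r, stolen := False\<rparr>"]) auto
      next
        case (Some p)
        then have "p \<noteq> t" using no_kid[of t f] t by auto
        show ?thesis
        proof (cases "forked f")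
          case True
          then show ?thesis using stolen_chain[OF t(2,3) Some] \<open>p \<noteq> t\<close> Some
            by (auto intro!: run.detached)
        next
          case False
          then have "run ?F p []" using stolen_chain[OF t(2,3) Some] \<open>p \<noteq> t\<close> chain by simp
          then show ?thesis
            by (rule run.called[where f = "f\<lparr>rest := r, stolen := False\<rparr>", rotated 4]) (use Some False in auto)
        qed
      qed
      then show ?thesis using True \<open>v = w\<close> stolen_queue[OF t] by simp
    qed (use 10 chain cur_chain in auto)
  next
    case (12 x g p)
    then have g: "F x = Some g" "stolen g" "parent g = Some p" by (auto split: if_splits)
    then have "p \<noteq> t" using no_kid by auto
    with stolen_chain[OF g] chain show ?case by (auto split: if_splits)
  qed (use cur_bound queue_distinct idle_queue in auto)
qed

lemma sched_steal:
  assumes w: "w < P" "cur w = None" and p: "queue v = p # q" "F p = Some f"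
  shows "sched P (F(p \<mapsto> f\<lparr>stolen := True\<rparr>)) (cur(w := Some p)) (queue(v := q)) (place(p := Running w))"
    (is "sched P ?F ?cur ?queue ?place")
proof -
  have pp: "place p = Queued v" using p queue_iff[of p v] by auto
  have pq: "p \<notin> set q" using queue_distinct[of v] p by simp
  \<comment> \<open>A queued task is not a caller.\<close>
  have forked_kid: "forked k" if "F y = Some k" "parent k = Some p" for y k
    using that calling_iff[of y p] pp by auto
  obtain x where x: "cur v = Some x" using idle_queue[of v] p by (cases "cur v") auto
  have xp: "x \<noteq> p" using x pp cur_iff[of v x] by auto
  have vw: "v \<noteq> w" using x w by auto
  have split: "run ?F x (rev q) \<and> run F p []"
    by (rule run_steal_oldest) (use cur_chain[OF x] p pq xp forked_kid in auto)
  have chain: "run ?F y Q" if "run F y Q" "p \<notin> set Q" "y = p \<longrightarrow> Q = []" for y Q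
    by (rule run_steal_other[OF that(1) p(2)]) (use forked_kid that in auto)
  have kid_iff: "(\<exists>h. ?F y = Some h \<and> Pr (forked h) (parent h)) \<longleftrightarrow> (\<exists>h. F y = Some h \<and> Pr (forked h) (parent h))" for y Pr
    using p by auto
  show ?thesis
  proof (rule sched.intro, goal_cases)
    case (1 u y)
    then show ?case using cur_iff[of u y] w p pp by auto
  next
    case (2 u y)
    then show ?case using cur_bound w by (auto split: if_splits)
  next
    case (3 y u)
    then show ?case using queue_iff[of y u] p pp pq by auto
  next
    case (4 u)
    then show ?case using queue_distinct[of u] queue_distinct[of v] p by auto
  next
    case (5 y z)
    then show ?case using calling_iff[of y z] kid_iff[of y "\<lambda>a b. \<not> a \<and> b = Some z"] p pp by auto
  next
    case (6 y g)
    then show ?case using waiting_iff[of y g] waiting_iff[of p f] p pp by (auto split: if_splits)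
  next
    case (7 y g)
    then show ?case using pp waiting[of y g] kid_iff[of _ "\<lambda>a b. a \<and> b = Some y"]
      by (auto split: if_splits)
  next
    case (8 y g z h)
    have old: "\<exists>h. F z = Some h \<and> forked h \<and> parent h = Some y"
      if "?F z = Some h" "forked h" "parent h = Some y" for z h
      using that kid_iff[of z "\<lambda>a b. a \<and> b = Some y"] by blast
    obtain h' where h': "F z = Some h'" "forked h'" "parent h' = Some y"
      using old[OF 8(3-5)] by blast
    have "y \<noteq> p" "F y = Some g" "\<not> stolen g" using 8(1,2) by (auto split: if_splits)
    note uc = unstolen_child[OF this(2,3) h']
    show ?case
    proof (intro conjI allI impI)
      show "\<exists>v. ?place y = Queued v" using uc \<open>y \<noteq> p\<close> by simp
      show "x = z" if "?F x = Some k" "forked k" "parent k = Some y" for x k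
        using uc old[OF that] by blast
    qed
  next
    case (9 y g)
    then show ?case using pp p join_ahead[of y g] join_ahead[of p f] by (auto split: if_splits)
  next
    case (10 u y)
    consider "u = w" "y = p" | "u = v" "y = x" | "u \<noteq> v" "u \<noteq> w" "cur u = Some y"
      using 10 x vw by (cases "u = w"; cases "u = v") auto
    then show ?case
    proof cases
      case 1
      then show ?thesis using idle_queue[OF w(2)] vw by (auto intro: run.thief)
    next
      case 2
      then show ?thesis using split by simp
    next
      case 3
      then have "p \<notin> set (queue u)" "y \<noteq> p" using queue_iff[of p u] cur_iff[of u y] pp by auto
      then show ?thesis using 3 chain[OF cur_chain[OF 3(3)]] by simp
    qed
  next
    case (11 u)
    then show ?case using idle_queue[of u] x by (auto split: if_splits)
  next
    case (12 y g r)
    show ?case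
    proof (cases "y = p \<and> \<not> stolen f")
      case False
      then obtain g' where g': "F y = Some g'" "stolen g'" "parent g' = Some r"
        "forked g' = forked g"
        using 12 p by (auto split: if_splits)
      then show ?thesis using stolen_chain[OF g'(1-3)] chain by (auto split: if_splits)
    next
      case True
      then have "parent f = Some r" "forked g = forked f" using 12 by auto
      \<comment> \<open>In a first theft the old walk from \<open>p\<close> is empty, and its last
        rule decides the alternative of \<open>stolen_chain\<close>: \<open>detached\<close> gives a
        stolen parent, \<open>called\<close> an empty walk from the caller.\<close>
      from split have "run F p []" by simp
      then show ?thesis
        by (cases rule: run.cases) (use True p \<open>parent f = Some r\<close> \<open>forked g = forked f\<close> chain in auto)
    qed
  qed
qed

text \<open>This serves \<open>return_root\<close> and \<open>return_not_last\<close>, after which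
  the worker has no task. A parent at a join point must keep another forked child, or
  \<open>waiting\<close> would fail for it.\<close>

lemma sched_finish:
  assumes t: "cur w = Some t" "F t = Some f" "\<not> stolen f" and q: "queue w = []"
    and p: "\<And>p fp. parent f = Some p \<Longrightarrow> F p = Some fp \<Longrightarrow> forked f \<and>
      (at_join fp \<longrightarrow> (\<exists>x g. x \<noteq> t \<and> F x = Some g \<and> forked g \<and> parent g = Some p))"
  shows "sched P (F(t := None)) (cur(w := None)) queue place"
    (is "sched P ?F ?cur _ _")
proof -
  have pt: "place t = Running w" using t cur_iff by auto
  have no_kid: "\<And>y k. F y = Some k \<Longrightarrow> parent k \<noteq> Some t" using running_childless[OF t] .
  have chain: "run ?F x Q" if "run F x Q" "x \<noteq> t" for x Q
    by (rule run_cong[OF that(1), of "- {t}"]) (use t that no_kid in \<open>auto simp: same_shape_def\<close>)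
  show ?thesis
  proof (rule sched.intro, goal_cases)
    case (1 v x)
    then show ?case using cur_iff[of v x] cur_iff[of w x] t pt by auto
  next
    case (2 v x)
    then show ?case using cur_bound by (auto split: if_splits)
  next
    case (3 x v)
    then show ?case using queue_iff[of x v] pt by auto
  next
    case (5 x y)
    have "\<not> (place y = Calling t \<and> y \<in> dom F)" using calling_iff[of t y] p t by fastforce
    then show ?case using calling_iff[of x y] pt t by auto
  next
    case (6 x g)
    then show ?case using waiting_iff[of x g] by (auto split: if_splits)
  next
    case (7 x g)
    then have x: "F x = Some g" "x \<noteq> t" by (auto split: if_splits)
    then have "stolen g" "at_join g" using waiting[OF x(1) 7(2)] waiting_iff[OF x(1)] 7(2) by auto
    moreover have "\<exists>y h. y \<noteq> t \<and> F y = Some h \<and> forked h \<and> parent h = Some x"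
    proof (cases "parent f = Some x")
      case True
      then show ?thesis using p[OF True x(1)] \<open>at_join g\<close> by blast
    next
      case False
      obtain y h where "F y = Some h" "forked h" "parent h = Some x"
        using waiting[OF x(1) 7(2)] by blast
      with False t(2) show ?thesis by (intro exI[of _ y] exI[of _ h]) auto
    qed
    ultimately show ?case by auto
  next
    case (8 x g y h)
    then have "F x = Some g" "\<not> stolen g" "F y = Some h" "forked h" "parent h = Some x"
      by (auto split: if_splits)
    from unstolen_child[OF this] show ?case by auto
  next
    case (9 x g)
    then show ?case using join_ahead[of x g] by (auto split: if_splits)
  next
    case (10 v x)
    then have "cur v = Some x" "x \<noteq> t" using cur_iff[of v x] pt by (auto split: if_splits)
    then show ?case using chain cur_chain by auto
  next
    case (11 v)
    then show ?case using idle_queue q by (auto split: if_splits)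
  next
    case (12 x g p)
    then have g: "F x = Some g" "stolen g" "parent g = Some p" by (auto split: if_splits)
    then have "p \<noteq> t" using no_kid by auto
    with stolen_chain[OF g] chain show ?case by (auto split: if_splits)
  qed (use queue_distinct in auto)
qed

text \<open>
  The alternatives for \<open>p\<close> are those of \<open>return_called\<close>, \<open>return_pop\<close> and \<open>return_last\<close>.
\<close>

lemma sched_resume:
  assumes t: "cur w = Some t" "F t = Some f" "\<not> stolen f" and p: "parent f = Some p" "F p = Some fp"
    and how: "place p = Calling t \<and> fp' = fp \<and> q = queue w \<or>
      place p = Queued w \<and> fp' = fp \<and> queue w = q @ [p] \<or>
      place p = Waiting \<and> fp' = fp\<lparr>stolen := False, at_join := False\<rparr> \<and> queue w = [] \<and> q = [] \<and>
        (\<forall>y k. F y = Some k \<longrightarrow> forked k \<longrightarrow> parent k = Some p \<longrightarrow> y = t)"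
  shows "sched P (F(t := None, p \<mapsto> fp')) (cur(w := Some p)) (queue(w := q)) (place(p := Running w))"
    (is "sched P ?F ?cur ?queue ?place")
proof -
  have pt: "place t = Running w" using t cur_iff by auto
  have tp: "t \<noteq> p" using parent_neq t(2) p(1) by blast
  have no_kid: "\<And>y k. F y = Some k \<Longrightarrow> parent k \<noteq> Some t" using running_childless[OF t] .
  have not_run: "cur v \<noteq> Some p" for v using how cur_iff[of v p] by auto
  have queue': "x \<in> set (?queue v) \<longleftrightarrow> x \<in> set (queue v) \<and> x \<noteq> p" for x v
    using how queue_iff[of p v] queue_distinct[of w] by (cases "v = w") auto
  have not_calling: "y = t" if "place p = Calling y" for y using that how by auto
  have shape: "parent fp' = parent fp" "forked fp' = forked fp" "home fp' = home fp"
    "rest fp' = rest fp"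
    "\<not> at_join fp'"
    using how waiting_iff[OF p(2)] by auto
  \<comment> \<open>If \<open>p\<close> is resumed without the flag, \<open>t\<close> was its only
    child: a called child is determined by \<open>place p\<close>, a forked one is unique by
    \<open>unstolen_child\<close> or by the assumption for a completed join.\<close>
  have gone: False if "\<not> stolen fp'" "y \<noteq> t" "F y = Some k" "parent k = Some p" for y k
  proof (cases "forked k")
    case True
    from how show False
    proof (elim disjE conjE)
      assume "place p = Calling t" "fp' = fp"
      then show False using unstolen_child[OF p(2) _ that(3) True that(4)] that(1) by auto
    next
      assume *: "place p = Queued w" "fp' = fp"
      then have "forked f" using calling_iff[of t p] t(2) p by auto
      then show False using unstolen_child[OF p(2) _ that(3) True that(4)] that(1,2) * t(2) p(1)
        by auto
    qed (use True that in blast)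
  next
    case False
    then have "place p = Calling y" using calling_iff[of y p] that(3,4) by blast
    then show False using not_calling that by auto
  qed
  have old: "F x = Some g \<and> x \<noteq> p \<or> x = p \<and> g = fp'" if "?F x = Some g" for x g
    using that by (auto split: if_splits)
  have kid_iff: "(\<exists>h. ?F y = Some h \<and> Pr (forked h) (parent h)) \<longleftrightarrow>
      y \<noteq> t \<and> (\<exists>h. F y = Some h \<and> Pr (forked h) (parent h))" for y Pr
    using p(2) tp shape by auto
  have same: "same_shape fp fp'" if "stolen fp' \<or> \<not> stolen fp"
    using that how by (auto simp: same_shape_def)
  \<comment> \<open>Clearing the flag would let walks through \<open>p\<close> continue to its
    parent. By \<open>gone\<close>, only \<open>t\<close> could lead to \<open>p\<close>, so
    \<open>D\<close> can leave out \<open>p\<close> together with \<open>t\<close>.\<close>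
  have chain: "run ?F x Q" if "run F x Q" "x \<noteq> t" "x = p \<longrightarrow> stolen fp' \<or> \<not> stolen fp" for x Q
  proof (cases "stolen fp' \<or> \<not> stolen fp")
    case True
    show ?thesis
      by (rule run_cong[OF that(1), of "- {t}"])
        (use that no_kid tp p same[OF True] in \<open>auto simp: same_shape_def\<close>)
  next
    case False
    show ?thesis
      by (rule run_cong[OF that(1), of "- {t, p}"])
        (use that no_kid gone False in \<open>auto simp: same_shape_def\<close>)
  qed
  have run_p: "run ?F p (rev q)"
    using how
  proof (elim disjE conjE)
    assume *: "place p = Calling t" "fp' = fp" "q = queue w"
    then have "\<not> forked f" using calling_iff[of t p] t(2) p by auto
    with cur_chain[OF t(1)] have "run F p (rev q)"
      by (cases rule: run.cases) (use t p * in auto)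
    then show ?thesis by (rule chain) (use tp * in auto)
  next
    assume *: "place p = Queued w" "fp' = fp" "queue w = q @ [p]"
    then have "forked f" using calling_iff[of t p] t(2) p by auto
    with cur_chain[OF t(1)] have "run F p (rev q)"
      by (cases rule: run.cases) (use t p * in auto)
    then show ?thesis by (rule chain) (use tp * in auto)
  next
    assume *: "place p = Waiting" "fp' = fp\<lparr>stolen := False, at_join := False\<rparr>" "q = []"
    then have st: "stolen fp" using waiting[OF p(2)] by simp
    have "run ?F p []"
    proof (cases "parent fp")
      case None
      then show ?thesis by (intro run.root[of _ _ fp']) (use * in auto)
    next
      case (Some r)
      then have r: "r \<noteq> t" "r \<noteq> p" using no_kid p(2) parent_neq[OF p(2) Some] by auto
      show ?thesis
      proof (cases "forked fp")
        case True
        then show ?thesis using stolen_chain[OF p(2) st Some] r Some *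
          by (auto intro!: run.detached)
      next
        case False
        then have "run ?F r []" using stolen_chain[OF p(2) st Some] r chain by simp
        then show ?thesis
          by (rule run.called[where f = fp', rotated 4]) (use Some False * in auto)
      qed
    qed
    with * show ?thesis by simp
  qed
  show ?thesis
  proof (rule sched.intro, goal_cases)
    case (1 v x)
    then show ?case using cur_iff[of v x] cur_iff[of w x] t p tp not_run[of v] pt by auto
  next
    case (2 v x)
    then show ?case using cur_bound t by (auto split: if_splits)
  next
    case (3 x v)
    show ?case unfolding queue' using queue_iff[of x v] pt by auto
  next
    case (4 v)
    then show ?case using how queue_distinct[of v] queue_distinct[of w] by auto
  next
    case (5 x y)
    then show ?case
      unfolding kid_iff[of x "\<lambda>a b. \<not> a \<and> b = Some y"]
        using calling_iff[of x y] calling_iff[of t y] not_calling[of x] pt p t by auto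
  next
    case (6 x g)
    then show ?case using waiting_iff[of x g] shape by (auto split: if_splits)
  next
    case (7 x g)
    then have x: "F x = Some g" "x \<noteq> p" "x \<noteq> t" by (auto split: if_splits)
    with waiting[OF x(1)] 7 obtain y h where h: "stolen g" "F y = Some h" "forked h"
      "parent h = Some x" by auto
    then have "y \<noteq> t" using x p t by auto
    then have "\<exists>h. ?F y = Some h \<and> forked h \<and> parent h = Some x"
      using h kid_iff[of y "\<lambda>a b. a \<and> b = Some x"] by blast
    with h(1) show ?case by blast
  next
    case (8 x g y h)
    have prev: "y \<noteq> t \<and> (\<exists>h. F y = Some h \<and> forked h \<and> parent h = Some x)"
      if "?F y = Some h" "forked h" "parent h = Some x" for y h
      using that kid_iff[of y "\<lambda>a b. a \<and> b = Some x"] by blast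
    obtain h' where h': "y \<noteq> t" "F y = Some h'" "forked h'" "parent h' = Some x"
      using prev[OF 8(3-5)] by blast
    have "x \<noteq> p" using gone[OF _ h'(1,2)] h'(4) 8(1,2) tp by auto
    then have x: "F x = Some g" using old[OF 8(1)] by simp
    note uc = unstolen_child[OF x 8(2) h'(2-4)]
    show ?case
    proof (intro conjI allI impI)
      show "\<exists>v. ?place x = Queued v" using uc \<open>x \<noteq> p\<close> by simp
      show "z = y" if "?F z = Some k" "forked k" "parent k = Some x" for z k
        using uc prev[OF that] by blast
    qed
  next
    case (9 x g)
    show ?case
    proof (cases "x = p")
      case True
      then show ?thesis using 9 how tp join_ahead[OF p(2)] by auto
    qed (use 9 join_ahead[of x g] in \<open>auto split: if_splits\<close>)
  next
    case (10 v x)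
    show ?case
    proof (cases "v = w")
      case False
      then have "cur v = Some x" "x \<noteq> t" "x \<noteq> p" using 10 cur_iff[of v x] pt not_run by auto
      with False show ?thesis using chain[OF cur_chain] by auto
    qed (use 10 run_p in auto)
  next
    case (11 v)
    then show ?case using idle_queue by (auto split: if_splits)
  next
    case (12 x g r)
    have "F x \<noteq> None" "x \<noteq> t" using 12(1) p(2) tp by (auto split: if_splits)
    then obtain g' where g: "F x = Some g'" "stolen g'" "parent g' = Some r" "forked g' = forked g"
      using 12 how p(2) by (auto split: if_splits)
    then have "r \<noteq> t" using no_kid by auto
    have r: "stolen fp'" if "r = p" using gone[OF _ \<open>x \<noteq> t\<close> g(1)] g(3) that by auto
    show ?case
    proof (cases "forked g")
      case True
      then show ?thesis using stolen_chain[OF g(1-3)] g(4) \<open>r \<noteq> t\<close> r by auto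
    next
      case False
      then show ?thesis using stolen_chain[OF g(1-3)] g(4) chain[of r] \<open>r \<noteq> t\<close> r by simp
    qed
  qed
qed

section \<open>Preservation of the whole invariant\<close>

lemma workers_update:
  assumes "w < P" "\<And>v x. v \<noteq> w \<Longrightarrow> cur v = Some x \<Longrightarrow> F' x = F x" "own' w < length sts'"
    "length sts \<le> length sts'"
    "\<And>v. v < P \<Longrightarrow> v \<noteq> w \<Longrightarrow> own v \<noteq> own' w \<and> on' (own v) = on (own v)"
    "case c of None \<Rightarrow> on' (own' w) = []
      | Some x \<Rightarrow> (\<exists>f. F' x = Some f \<and> (if stolen f then on' (own' w) = [] else (\<exists>S. on' (own' w) = x # S)))"
    "\<And>v. v \<noteq> w \<Longrightarrow> own' v = own v"
  shows "workers P F' sts' on' (cur(w := c)) own'"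
proof
  show "inj_on own' {..<P}"
  proof (rule inj_onI)
    fix u v assume uv: "u \<in> {..<P}" "v \<in> {..<P}" "own' u = own' v"
    then show "u = v" using assms(5)[of u] assms(5)[of v] assms(7)[of u] assms(7)[of v] own_inj
      by (cases "u = w"; cases "v = w") (auto dest: inj_onD)
  qed
  fix v assume v: "v < P"
  show "own' v < length sts'" using assms(3,4,7) own_bound[OF v] by (cases "v = w") force+
  show "case (cur(w := c)) v of None \<Rightarrow> on' (own' v) = []
      | Some x \<Rightarrow> (\<exists>f. F' x = Some f \<and> (if stolen f then on' (own' v) = [] else (\<exists>S. on' (own' v) = x # S)))"
    using assms(6) own_top[OF v] assms(2)[of v] assms(5)[OF v] assms(7)[of v]
    by (cases "v = w") (auto split: option.splits)
qed

lemma inv_start: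
  assumes t: "cur w = Some t" "F t = Some f" and r: "rest f = i # r"
    and i: "if frk then i = Fork u else i = Call u" and n: "F n = None"
  shows "inv P root (F(t \<mapsto> f\<lparr>rest := r\<rparr>, n \<mapsto> \<lparr>parent = Some t, forked = frk, home = own w, rest = body u,
      stolen = False, at_join = False\<rparr>)) (sts[own w := alloc (frame_size u) (sts ! own w)])
      (cur(w := Some n)) own (queue(w := queue w @ (if frk then [t] else [])))
      (task_of(n := u)) (lineage(n := n # lineage t)) (on(own w := n # on (own w)))
      (place(t := if frk then Queued w else Calling n, n := Running w))"
    (is "inv P root ?F ?sts ?cur own ?queue ?task_of ?lineage ?on ?place")
proof (rule inv.intro)
  have nt: "n \<noteq> t" using t n by auto
  have u: "u \<in> children (task_of t)" using child_of_rest[OF t(2) r] i by (auto split: if_splits)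
  have nop: "parent g \<noteq> Some n" if "F x = Some g" for x g using parent that n by fastforce
  have w: "w < P" using cur_bound t(1) .
  interpret upd: tree root "F(t \<mapsto> f\<lparr>rest := r\<rparr>)" task_of lineage
    by (rule tree_update[of _ f _ "[i]"]) (use t r in auto)
  show "tree root ?F ?task_of ?lineage"
    by (rule upd.tree_insert[of _ "f\<lparr>rest := r\<rparr>"]) (use nt n u in auto)
  interpret upd: store "F(t \<mapsto> f\<lparr>rest := r\<rparr>)" sts task_of on
    by (rule store_update[of _ f]) (use t in auto)
  show "store ?F ?sts ?task_of ?on"
    by (rule upd.store_push[of _ t "f\<lparr>rest := r\<rparr>"])
      (use nt n t nop own_bound[OF w] own_top[OF w] in \<open>auto split: if_splits\<close>)
  show "sched P ?F ?cur ?queue ?place" by (rule sched_start[OF t r i n])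
  have "cur v \<noteq> Some t" "cur v \<noteq> Some n" if "v \<noteq> w" for v
    using cur_iff[of v t] cur_iff[of v n] cur_iff[of w t] t(1) n that by auto
  then show "workers P ?F ?sts ?on ?cur own"
    using w own_bound[OF w] own_inj by (intro workers_update) (auto dest: inj_onD)
  show "inv_axioms root" using strict by (rule inv_axioms.intro)
qed

text \<open>The thief keeps its empty stack, which is what \<open>own_top\<close> demands for a
  stolen task.\<close>

lemma inv_steal:
  assumes w: "w < P" "cur w = None" and p: "queue v = p # q" "F p = Some f"
  shows "inv P root (F(p \<mapsto> f\<lparr>stolen := True\<rparr>)) sts (cur(w := Some p)) own (queue(v := q))
    task_of lineage on (place(p := Running w))"
proof (rule inv.intro)
  have pp: "place p = Queued v" using p queue_iff[of p v] by auto
  show "tree root (F(p \<mapsto> f\<lparr>stolen := True\<rparr>)) task_of lineage"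
    by (rule tree_update[of _ f _ "[]"]) (use p in auto)
  show "store (F(p \<mapsto> f\<lparr>stolen := True\<rparr>)) sts task_of on"
  proof (rule store_update[OF p(2)])
    show "stolen f \<or> (\<forall>x g. F x = Some g \<longrightarrow> parent g = Some p \<longrightarrow> forked g)"
      using calling_iff[of _ p] pp by fastforce
  qed auto
  show "sched P (F(p \<mapsto> f\<lparr>stolen := True\<rparr>)) (cur(w := Some p)) (queue(v := q)) (place(p := Running w))"
    by (rule sched_steal[OF w p])
  have "cur u \<noteq> Some p" for u using cur_iff[of u p] pp by simp
  then show "workers P (F(p \<mapsto> f\<lparr>stolen := True\<rparr>)) sts on (cur(w := Some p)) own"
    using w own_top[OF w(1)] own_bound[OF w(1)] own_inj
      by (intro workers_update) (auto dest: inj_onD)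
  show "inv_axioms root" using strict by (rule inv_axioms.intro)
qed

lemma inv_join_unstolen:
  assumes t: "cur w = Some t" "F t = Some f" "rest f = i # r" "\<not> stolen f"
  shows "inv P root (F(t \<mapsto> f\<lparr>rest := r\<rparr>)) sts cur own queue task_of lineage on place"
proof (rule inv.intro)
  show "tree root (F(t \<mapsto> f\<lparr>rest := r\<rparr>)) task_of lineage"
    by (rule tree_update[of _ f _ "[i]"]) (use t in auto)
  show "store (F(t \<mapsto> f\<lparr>rest := r\<rparr>)) sts task_of on"
    by (rule store_update[of _ f]) (use t in auto)
  show "sched P (F(t \<mapsto> f\<lparr>rest := r\<rparr>)) cur queue place"
    by (rule sched_join_unstolen[OF t(1,2,4)])
  have w: "w < P" using cur_bound t(1) .
  have "cur v \<noteq> Some t" if "v \<noteq> w" for v using cur_iff[of v t] cur_iff[of w t] t(1) that by auto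
  then have "workers P (F(t \<mapsto> f\<lparr>rest := r\<rparr>)) sts on (cur(w := Some t)) own"
    using w t own_top[OF w] own_bound[OF w] own_inj by (intro workers_update) (auto dest: inj_onD)
  with t(1) show "workers P (F(t \<mapsto> f\<lparr>rest := r\<rparr>)) sts on cur own" by (simp add: fun_upd_idem)
  show "inv_axioms root" using strict by (rule inv_axioms.intro)
qed

lemma inv_join_wait:
  assumes t: "cur w = Some t" "F t = Some f" "rest f = i # r" "stolen f"
    and kid: "F y = Some k" "forked k" "parent k = Some t"
  shows "inv P root (F(t \<mapsto> f\<lparr>rest := r, at_join := True\<rparr>)) sts (cur(w := None)) own queue
    task_of lineage on (place(t := Waiting))"
proof (rule inv.intro)
  show "tree root (F(t \<mapsto> f\<lparr>rest := r, at_join := True\<rparr>)) task_of lineage"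
    by (rule tree_update[of _ f _ "[i]"]) (use t in auto)
  show "store (F(t \<mapsto> f\<lparr>rest := r, at_join := True\<rparr>)) sts task_of on"
    by (rule store_update[of _ f]) (use t in auto)
  show "sched P (F(t \<mapsto> f\<lparr>rest := r, at_join := True\<rparr>)) (cur(w := None)) queue (place(t := Waiting))"
    by (rule sched_join_wait[OF t(1,2,4) kid])
  have w: "w < P" using cur_bound t(1) .
  have "cur v \<noteq> Some t" if "v \<noteq> w" for v using cur_iff[of v t] cur_iff[of w t] t(1) that by auto
  then show "workers P (F(t \<mapsto> f\<lparr>rest := r, at_join := True\<rparr>)) sts on (cur(w := None)) own"
    using w t own_top[OF w] own_bound[OF w] own_inj by (intro workers_update) (auto dest: inj_onD)
  show "inv_axioms root" using strict by (rule inv_axioms.intro)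
qed

lemma inv_join_last:
  assumes t: "cur w = Some t" "F t = Some f" "rest f = i # r" "stolen f"
    and joined: "\<And>y k. F y = Some k \<Longrightarrow> forked k \<Longrightarrow> parent k \<noteq> Some t"
  shows "inv P root (F(t \<mapsto> f\<lparr>rest := r, stolen := False\<rparr>)) sts cur (own(w := home f)) queue
    task_of lineage on place"
proof (rule inv.intro)
  have w: "w < P" using cur_bound t(1) .
  have no_kid: "parent k \<noteq> Some t" if "F y = Some k" for y k
    using joined[OF that] calling_iff[of y t] cur_iff[of w t] t that by auto
  show "tree root (F(t \<mapsto> f\<lparr>rest := r, stolen := False\<rparr>)) task_of lineage"
    by (rule tree_update[of _ f _ "[i]"]) (use t in auto)
  show "store (F(t \<mapsto> f\<lparr>rest := r, stolen := False\<rparr>)) sts task_of on"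
    by (rule store_update[of _ f]) (use t no_kid in auto)
  show "sched P (F(t \<mapsto> f\<lparr>rest := r, stolen := False\<rparr>)) cur queue place"
    by (rule sched_join_last[OF t(1,2,4) no_kid])
  obtain S where S: "on (home f) = t # S" using top_of_home[OF t(2)] no_kid by blast
  \<comment> \<open>A worker owning the home of \<open>t\<close> would have \<open>t\<close> on top
    and hence be executing it. So it would be \<open>w\<close>, whose stack is a different one
    because \<open>t\<close> is stolen.\<close>
  have other: "own v \<noteq> home f" if "v < P" for v
  proof
    assume "own v = home f"
    with own_top[OF that] S have "cur v = Some t" by (auto split: option.splits if_splits)
    then have "v = w" using cur_iff t(1) by simp
    with \<open>own v = home f\<close> show False using own_eq_home[OF t(1,2)] t(4) by simp
  qed
  have "cur v \<noteq> Some t" if "v \<noteq> w" for v using cur_iff[of v t] cur_iff[of w t] t(1) that by auto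
  moreover have "home f < length sts" using on_beyond[of "home f"] S
    by (cases "home f < length sts") auto
  ultimately have "workers P (F(t \<mapsto> f\<lparr>rest := r, stolen := False\<rparr>)) sts on (cur(w := Some t)) (own(w := home f))"
    using w other S by (intro workers_update) auto
  with t(1) show "workers P (F(t \<mapsto> f\<lparr>rest := r, stolen := False\<rparr>)) sts on cur (own(w := home f))"
    by (simp add: fun_upd_idem)
  show "inv_axioms root" using strict by (rule inv_axioms.intro)
qed

text \<open>By \<open>nested\<close>, popping \<open>t\<close> either uncovers its parent or leaves
  an empty stack; in the latter case the parent, if any, is stolen.\<close>

lemma finished_top:
  assumes t: "cur w = Some t" "F t = Some f" "rest f = []"
  obtains S where "on (own w) = t # S" "own w = home f" "\<not> stolen f"
    "parent f = None \<Longrightarrow> S = []"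
    "\<And>p fp. parent f = Some p \<Longrightarrow> F p = Some fp \<Longrightarrow>
      S = [] \<and> stolen fp \<or> (\<exists>S'. S = p # S') \<and> home fp = own w"
proof -
  have ns: "\<not> stolen f" by (rule finished_unstolen[OF t])
  then obtain S where S: "on (own w) = t # S" using own_top[OF cur_bound[OF t(1)]] t by auto
  have nst: "nested F (t # S)" using on_nested[of "own w"] S by simp
  have "parent f = Some q" "F q = Some fq \<Longrightarrow> home fq = own w" if "S = q # S'" for q S' fq
    using nst that t(2) on_iff[of q "own w"] S by auto
  with nst t(2) ns show ?thesis
    by (intro that[OF S]) (use own_eq_home[OF t(1,2)] in \<open>cases S; auto\<close>)+
qed

lemma finish_frames:
  assumes t: "cur w = Some t" "F t = Some f" "rest f = []" and d: "dealloc (sts ! own w) g"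
    and S: "on (own w) = t # S"
  shows "tree root (F(t := None)) task_of lineage"
    "store (F(t := None)) (sts[own w := g]) task_of (on(own w := S))"
proof -
  have "parent k \<noteq> Some t" if "F x = Some k" for x k
    using running_childless[OF t(1,2) finished_unstolen[OF t] that] .
  then show "tree root (F(t := None)) task_of lineage"
    "store (F(t := None)) (sts[own w := g]) task_of (on(own w := S))"
    using tree_remove store_pop[OF S d] by blast+
qed

text \<open>The first entry that a walk from a forked task can collect is its parent. So a worker
  that cannot pop the parent has an empty queue.\<close>

lemma finished_queue:
  assumes t: "cur w = Some t" "F t = Some f" "\<not> stolen f"
  shows "parent f = None \<Longrightarrow> queue w = []"
    and "parent f = Some p \<Longrightarrow> forked f \<Longrightarrow> queue w \<noteq> [] \<Longrightarrow>
      \<exists>q fp. queue w = q @ [p] \<and> F p = Some fp \<and> (stolen fp \<longrightarrow> home f \<noteq> home fp)"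
proof -
  show "queue w = []" if "parent f = None"
    using cur_chain[OF t(1)] by (cases rule: run.cases) (use t that in auto)
  show "\<exists>q fp. queue w = q @ [p] \<and> F p = Some fp \<and> (stolen fp \<longrightarrow> home f \<noteq> home fp)"
    if "parent f = Some p" "forked f" "queue w \<noteq> []"
    using cur_chain[OF t(1)]
  proof (cases rule: run.cases)
    case (queued f' p' fp Q)
    then have "queue w = rev Q @ [p']" by (metis rev.simps(2) rev_rev_ident)
    then show ?thesis using queued t that by auto
  qed (use t that in auto)
qed

text \<open>If the parent lives elsewhere or does not exist, popping leaves an empty stack, which
  the worker keeps. Otherwise frames may remain; the worker abandons them together with the stack,
  which still counts in \<open>sts\<close>.\<close>

lemma inv_finish:
  assumes t: "cur w = Some t" "F t = Some f" "rest f = []" and d: "dealloc (sts ! own w) g"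
    and q: "queue w = []"
    and p: "\<And>p fp. parent f = Some p \<Longrightarrow> F p = Some fp \<Longrightarrow> forked f \<and>
      (at_join fp \<longrightarrow> (\<exists>x g. x \<noteq> t \<and> F x = Some g \<and> forked g \<and> parent g = Some p))"
  shows "(\<And>p fp. parent f = Some p \<Longrightarrow> F p = Some fp \<Longrightarrow> own w \<noteq> home fp) \<Longrightarrow>
      \<exists>on. inv P root (F(t := None)) (sts[own w := g]) (cur(w := None)) own queue task_of lineage on place"
    and "\<exists>on. inv P root (F(t := None)) (sts[own w := g] @ [empty_stack]) (cur(w := None))
        (own(w := length sts)) queue task_of lineage on place"
proof -
  have w: "w < P" using cur_bound t(1) .
  obtain S where S: "on (own w) = t # S" and ns: "\<not> stolen f" and
    bottom: "parent f = None \<Longrightarrow> S = []" "\<And>p fp. parent f = Some p \<Longrightarrow> F p = Some fp \<Longrightarrow>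
      S = [] \<and> stolen fp \<or> (\<exists>S'. S = p # S') \<and> home fp = own w"
    using finished_top[OF t] by metis
  note frames = finish_frames[OF t d S]
  have sched: "sched P (F(t := None)) (cur(w := None)) queue place"
    by (rule sched_finish[OF t(1,2) ns q p])
  have cur: "cur v \<noteq> Some t" if "v \<noteq> w" for v
    using cur_iff[of v t] cur_iff[of w t] t(1) that by auto
  show "\<exists>on. inv P root (F(t := None)) (sts[own w := g]) (cur(w := None)) own queue task_of lineage on place"
    if "\<And>p fp. parent f = Some p \<Longrightarrow> F p = Some fp \<Longrightarrow> own w \<noteq> home fp"
  proof -
    have "S = []"
    proof (cases "parent f")
      case (Some p)
      then obtain fp where "F p = Some fp" using parent[OF t(2)] by blast
      then show ?thesis using bottom(2) that Some by metis
    qed (use bottom in auto)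
    then have "workers P (F(t := None)) (sts[own w := g]) (on(own w := S)) (cur(w := None)) own"
      using w cur own_bound[OF w] own_inj by (intro workers_update) (auto dest: inj_onD)
    then show ?thesis using inv.intro[OF frames sched] inv_axioms.intro[OF strict] by blast
  qed
  show "\<exists>on. inv P root (F(t := None)) (sts[own w := g] @ [empty_stack]) (cur(w := None))
        (own(w := length sts)) queue task_of lineage on place"
  proof -
    have "own v \<noteq> own w" if "v < P" "v \<noteq> w" for v using own_inj that w by (auto dest: inj_onD)
    moreover have "own v < length sts" if "v < P" for v using own_bound that .
    moreover have "on (length sts) = []" by (rule on_beyond) simp
    moreover have "own w \<noteq> length sts" "length sts \<noteq> own w" using own_bound[OF w] by auto
    ultimately have "workers P (F(t := None)) (sts[own w := g] @ [empty_stack]) (on(own w := S))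
        (cur(w := None)) (own(w := length sts))"
      using w cur by (intro workers_update) (auto simp: less_imp_neq)
    then show ?thesis
      using inv.intro[OF frames(1) store.store_new_stack[OF frames(2)] sched] inv_axioms.intro[OF strict] by blast
  qed
qed

lemma inv_resume:
  assumes t: "cur w = Some t" "F t = Some f" "rest f = []" and d: "dealloc (sts ! own w) g"
    and p: "parent f = Some p" "F p = Some fp"
    and how: "\<not> forked f \<and> q = queue w \<or> forked f \<and> queue w = q @ [p]"
  shows "\<exists>on place. inv P root (F(t := None)) (sts[own w := g]) (cur(w := Some p)) own (queue(w := q))
    task_of lineage on place"
proof -
  have w: "w < P" using cur_bound t(1) .
  obtain S where S: "on (own w) = t # S" "own w = home f" and ns: "\<not> stolen f" and
    bottom: "S = [] \<and> stolen fp \<or> (\<exists>S'. S = p # S') \<and> home fp = own w"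
    using finished_top[OF t] p by metis
  note frames = finish_frames[OF t d S(1)]
  have tp: "t \<noteq> p" using parent_neq t(2) p(1) by blast
  have F': "F(t := None, p \<mapsto> fp) = F(t := None)" using p(2) tp by auto
  have "place p = Calling t \<and> q = queue w \<or> place p = Queued w \<and> queue w = q @ [p]"
    using how calling_iff[of t p] queue_iff[of p w] t(2) p by auto
  then have "sched P (F(t := None, p \<mapsto> fp)) (cur(w := Some p)) (queue(w := q)) (place(p := Running w))"
    by (intro sched_resume[OF t(1,2) ns p]) auto
  then have sched: "sched P (F(t := None)) (cur(w := Some p)) (queue(w := q)) (place(p := Running w))"
    unfolding F' .
  have cur: "cur v \<noteq> Some t" if "v \<noteq> w" for v
    using cur_iff[of v t] cur_iff[of w t] t(1) that by auto
  \<comment> \<open>A parent resumed with an old theft mark had its child on another stack, so that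
    the worker's stack is now empty, in accordance with \<open>own_top\<close>.\<close>
  have "stolen fp \<Longrightarrow> home f \<noteq> home fp"
    using how called_off_home[OF t(2) p] finished_queue(2)[OF t(1,2) ns p(1)] p(2) by auto
  with bottom S(2) have top: "if stolen fp then S = [] else \<exists>S'. S = p # S'" by auto
  have "workers P (F(t := None)) (sts[own w := g]) (on(own w := S)) (cur(w := Some p)) own"
    using w cur own_bound[OF w] own_inj p tp top by (intro workers_update) (auto dest: inj_onD)
  then show ?thesis using inv.intro[OF frames sched] inv_axioms.intro[OF strict] by blast
qed

lemma inv_resume_last:
  assumes t: "cur w = Some t" "F t = Some f" "rest f = []" and d: "dealloc (sts ! own w) g"
    and p: "parent f = Some p" "F p = Some fp" and "forked f" and q: "\<not> (\<exists>q. queue w = q @ [p])"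
    and at: "at_join fp" and joined: "\<And>y k. y \<noteq> t \<Longrightarrow> F y = Some k \<Longrightarrow> forked k \<Longrightarrow> parent k \<noteq> Some p"
  shows "\<exists>on place. inv P root (F(t := None, p \<mapsto> fp\<lparr>stolen := False, at_join := False\<rparr>)) (sts[own w := g])
    (cur(w := Some p)) (own(w := home fp)) queue task_of lineage on place"
    (is "\<exists>on place. inv P root ?F _ _ _ _ _ _ on place")
proof -
  have w: "w < P" using cur_bound t(1) .
  obtain S where S: "on (own w) = t # S" "own w = home f" and ns: "\<not> stolen f" and
    bottom: "S = [] \<and> stolen fp \<or> (\<exists>S'. S = p # S') \<and> home fp = own w"
    using finished_top[OF t] p by metis
  note frames = finish_frames[OF t d S(1)]
  have tp: "t \<noteq> p" using parent_neq t(2) p(1) by blast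
  have pw: "place p = Waiting" using at waiting_iff[OF p(2)] by simp
  have qw: "queue w = []" using finished_queue(2)[OF t(1,2) ns p(1) \<open>forked f\<close>] q by blast
  have "sched P ?F (cur(w := Some p)) (queue(w := [])) (place(p := Running w))"
    by (intro sched_resume[OF t(1,2) ns p]) (use pw qw joined in auto)
  then have sched: "sched P ?F (cur(w := Some p)) queue (place(p := Running w))"
    using qw by (simp add: fun_upd_idem)
  have no_kid: "parent k \<noteq> Some p" if "(F(t := None)) y = Some k" for y k
    using joined[of y k] that calling_iff[of y p] pw by (auto split: if_splits)
  have Fp: "(F(t := None)) p = Some fp" using p(2) tp by simp
  interpret rem: tree root "F(t := None)" task_of lineage by (rule frames)
  interpret rem: store "F(t := None)" "sts[own w := g]" task_of "on(own w := S)" by (rule frames)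
  have tree: "tree root ?F task_of lineage" by (rule rem.tree_update[OF Fp, of _ "[]"]) simp_all
  have store: "store ?F (sts[own w := g]) task_of (on(own w := S))"
    by (rule rem.store_update[OF Fp]) (use no_kid in auto)
  obtain S' where S': "(on(own w := S)) (home fp) = p # S'"
    using rem.top_of_home[OF Fp] no_kid by blast
  have cur: "cur v \<noteq> Some t" if "v \<noteq> w" for v
    using cur_iff[of v t] cur_iff[of w t] t(1) that by auto
  have cur_p: "cur v \<noteq> Some p" for v using cur_iff[of v p] pw by auto
  have ne: "own v \<noteq> own w" if "v < P" "v \<noteq> w" for v using own_inj that w by (auto dest: inj_onD)
  \<comment> \<open>A worker whose stack has \<open>p\<close> on top would be executing
    \<open>p\<close>, but \<open>p\<close> is waiting.\<close>
  have other: "own v \<noteq> home fp" if "v < P" "v \<noteq> w" for v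
  proof
    assume "own v = home fp"
    with S' ne[OF that] have "on (own v) = p # S'" by (auto split: if_splits)
    with own_top[OF that(1)] cur_p[of v] show False by (auto split: option.splits if_splits)
  qed
  have "home fp < length (sts[own w := g])"
    using rem.on_beyond[of "home fp"] S' by (cases "home fp < length (sts[own w := g])") auto
  then have "workers P ?F (sts[own w := g]) (on(own w := S)) (cur(w := Some p)) (own(w := home fp))"
    using w cur cur_p S' ne other by (intro workers_update) auto
  then show ?thesis using inv.intro[OF tree store sched] inv_axioms.intro[OF strict] by blast
qed

section \<open>From the invariant to the memory bound\<close>

text \<open>Among the live tasks below \<open>x\<close>, including \<open>x\<close>, one with a
  longest lineage is a leaf. A leaf is neither queued nor calling nor waiting, since each of these
  requires a live child; hence it is running.\<close>

lemma live_covered: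
  assumes "x \<in> dom F"
  shows "\<exists>w t. cur w = Some t \<and> x \<in> set (lineage t)"
proof -
  have lin: "y \<in> set (lineage y)" if "F y = Some f" for y f
    using no_parent[OF that] parent[OF that] by (cases "parent f") auto
  define A where "A = {y \<in> dom F. x \<in> set (lineage y)}"
  have "finite A" "x \<in> A" using finite_frames assms lin by (auto simp: A_def)
  then have "Max ((\<lambda>y. length (lineage y)) ` A) \<in> (\<lambda>y. length (lineage y)) ` A"
    by (intro Max_in) auto
  then obtain y where y: "y \<in> A" and "length (lineage y) = Max ((\<lambda>y. length (lineage y)) ` A)"
    by auto
  with \<open>finite A\<close> have max: "length (lineage z) \<le> length (lineage y)" if "z \<in> A" for z
    using that by simp
  have leaf: "parent g \<noteq> Some y" if g: "F z = Some g" for z g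
  proof
    assume "parent g = Some y"
    then have "lineage z = z # lineage y" using parent[OF g] by blast
    moreover from this have "z \<in> A" using y g by (auto simp: A_def)
    ultimately show False using max[of z] by simp
  qed
  obtain f where f: "F y = Some f" using y by (auto simp: A_def)
  show ?thesis
  proof (cases "place y")
    case (Running w)
    then have "cur w = Some y" using cur_iff f by auto
    with y show ?thesis by (auto simp: A_def)
  next
    case (Queued v)
    then have q: "y \<in> set (queue v)" using queue_iff f by auto
    then obtain t where "cur v = Some t" using idle_queue[of v] by (cases "cur v") auto
    then show ?thesis using run_queued_child[OF cur_chain, of v t y] q leaf by auto
  next
    case (Calling z)
    then show ?thesis using calling_iff[of z y] f leaf by auto
  next
    case Waiting
    then show ?thesis using waiting[OF f] leaf by blast
  qed
qed

lemma lineage_dag_path: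
  assumes "x \<in> dom F"
  shows "dag_path root (rev (map task_of (lineage x))) \<and> last (rev (map task_of (lineage x))) = task_of x"
  using assms
proof (induction "length (lineage x)" arbitrary: x rule: less_induct)
  case less
  then obtain f where f: "F x = Some f" by auto
  show ?case
  proof (cases "parent f")
    case None
    then show ?thesis using no_parent[OF f] by (simp add: dag_path_def)
  next
    case (Some p)
    note par = parent[OF f Some]
    then have "dag_path root (rev (map task_of (lineage p)))"
      "last (rev (map task_of (lineage p))) = task_of p" using less.hyps[of p] by auto
    with par show ?thesis by (auto simp: dag_path_def successively_append_iff)
  qed
qed

lemma lineage_le_M1: "x \<in> dom F \<Longrightarrow> (\<Sum>y\<leftarrow>lineage x. frame_size (task_of y)) \<le> M1 root"
  using M1_ge[of root "rev (map task_of (lineage x))"] lineage_dag_path[of x]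
  by (simp add: rev_map[symmetric] comp_def)

lemma live_size_le: "(\<Sum>x\<in>dom F. frame_size (task_of x)) \<le> P * M1 root"
proof -
  define A where "A w = (case cur w of None \<Rightarrow> {} | Some t \<Rightarrow> set (lineage t))" for w
  have fin: "finite (A w)" for w by (auto simp: A_def split: option.split)
  have "dom F \<subseteq> (\<Union>w<P. A w)"
  proof
    fix x assume "x \<in> dom F"
    then obtain w t where "cur w = Some t" "x \<in> set (lineage t)" using live_covered by blast
    with cur_bound[of w t] show "x \<in> (\<Union>w<P. A w)" by (auto simp: A_def intro!: bexI[of _ w])
  qed
  then have "(\<Sum>x\<in>dom F. frame_size (task_of x)) \<le> (\<Sum>x\<in>(\<Union>w<P. A w). frame_size (task_of x))"
    using fin by (intro sum_mono2) auto
  also have "\<dots> \<le> (\<Sum>w<P. \<Sum>x\<in>A w. frame_size (task_of x))"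
    using fin by (intro sum_UN_le) auto
  also have "\<dots> \<le> (\<Sum>w<P. M1 root)"
  proof (rule sum_mono)
    fix w
    show "(\<Sum>x\<in>A w. frame_size (task_of x)) \<le> M1 root"
    proof (cases "cur w")
      case (Some t)
      then have "t \<in> dom F" using cur_iff by blast
      then show ?thesis
        using lineage_le_M1[of t] sum_set_le_sum_list[of "\<lambda>x. frame_size (task_of x)" "lineage t"] Some
        by (simp add: A_def)
    qed (simp add: A_def)
  qed
  finally show ?thesis by simp
qed

lemma memory_le:
  assumes "2 \<le> c" "nonempty_frames root"
  shows "(\<Sum>g\<leftarrow>sts. segstack_memory c g) \<le> (2 * c + 3) * P * M1 root"
proof -
  let ?s = "\<lambda>x. frame_size (task_of x)"
  have each: "segstack_memory c (sts ! g) \<le> (2 * c + 3) * (\<Sum>x\<in>set (on g). ?s x)"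
    if g: "g < length sts" for g
  proof -
    have "1 \<le> m" if "m \<in> set (contents (sts ! g))" for m
    proof -
      obtain x where "m = ?s x" "x \<in> set (on g)" using stack_contents[OF g] \<open>m \<in> _\<close> by auto
      then show ?thesis using on_iff[of x g] task_of_mem assms(2)
        by (auto simp: nonempty_frames_def)
    qed
    then have "segstack_memory c (sts ! g) \<le> (2 * c + 3) * sum_list (contents (sts ! g))"
      using segstack_memory_le stack_contents[OF g] assms(1) by blast
    then show ?thesis using stack_contents[OF g] on_distinct[of g]
      by (simp add: sum_list_distinct_conv_sum_set)
  qed
  have "(\<Sum>g\<leftarrow>sts. segstack_memory c g) = (\<Sum>g<length sts. segstack_memory c (sts ! g))"
    by (simp add: sum_list_sum_nth atLeast0LessThan)
  also have "\<dots> \<le> (\<Sum>g<length sts. (2 * c + 3) * (\<Sum>x\<in>set (on g). ?s x))"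
    by (rule sum_mono) (use each in auto)
  \<comment> \<open>Each frame has a single \<open>home\<close>, so distinct stacks hold disjoint
    sets of tasks.\<close>
  also have "\<dots> = (2 * c + 3) * (\<Sum>x\<in>(\<Union>g<length sts. set (on g)). ?s x)"
    unfolding sum_distrib_left[symmetric]
    by (subst sum.UNION_disjoint) (auto simp: on_iff)
  also have "\<dots> \<le> (2 * c + 3) * (\<Sum>x\<in>dom F. ?s x)"
    using finite_frames by (intro mult_le_mono2 sum_mono2) (auto simp: on_iff)
  also have "\<dots> \<le> (2 * c + 3) * (P * M1 root)" by (rule mult_le_mono2[OF live_size_le])
  finally show ?thesis by (simp add: mult.assoc)
qed

end

text \<open>The quantified functions are ghost state: they describe a configuration without being
  part of it, and each step supplies new ones.\<close>

definition consistent :: "nat \<Rightarrow> task \<Rightarrow> config \<Rightarrow> bool" where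
  "consistent P root s \<longleftrightarrow> (\<exists>task_of lineage on place. inv P root (frames s) (stacks s) (current s) (own s) (wsq s)
     task_of lineage on place)"

lemma consistent_initial:
  assumes "initial P root s" "fully_strict root"
  shows "consistent P root s"
proof -
  obtain w where w: "w < P" and s: "s = \<lparr>
     frames = [0 \<mapsto> \<lparr>parent = None, forked = False, home = w, rest = body root,
                   stolen = False, at_join = False\<rparr>],
     stacks = (replicate P empty_stack)[w := alloc (frame_size root) empty_stack],
     current = (\<lambda>_. None)(w := Some 0),
     own = (\<lambda>v. v),
     wsq = (\<lambda>_. [])\<rparr>" using assms(1) unfolding initial_def by blast
  \<comment> \<open>Constants do for the lineage, the place and the task because the invariant
    consults them at live identifiers only, and 0 is the only one.\<close>
  have "inv P root (frames s) (stacks s) (current s) (own s) (wsq s) (\<lambda>_. root) (\<lambda>_. [0])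
      ((\<lambda>_. [])(w := [0])) (\<lambda>_. Running w)"
  proof (rule inv.intro)
    show "tree root (frames s) (\<lambda>_. root) (\<lambda>_. [0])"
      by unfold_locales (auto simp: s tasks_of.root split: if_splits)
    show "store (frames s) (stacks s) (\<lambda>_. root) ((\<lambda>_. [])(w := [0]))"
      using w by unfold_locales
        (auto simp: s nth_list_update valid_stack_alloc valid_empty_stack contents_alloc split: if_splits)
    have "run (frames s) 0 []" by (rule run.root) (auto simp: s)
    then show "sched P (frames s) (current s) (wsq s) (\<lambda>_. Running w)"
      using w by unfold_locales (auto simp: s split: if_splits)
    show "workers P (frames s) (stacks s) ((\<lambda>_. [])(w := [0])) (current s) (own s)"
      using w by unfold_locales (auto simp: s)
  qed (rule inv_axioms.intro[OF assms(2)])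
  then show ?thesis unfolding consistent_def by blast
qed

section \<open>Executions\<close>

lemma children_done_drop_frame:
  "children_done (drop_frame w t g s) p \<longleftrightarrow>
    \<not> (\<exists>x h. x \<noteq> t \<and> frames s x = Some h \<and> forked h \<and> parent h = Some p)"
  unfolding children_done_def drop_frame_def by (simp, metis)

lemma consistent_step:
  assumes "step P s s'" "consistent P root s"
  shows "consistent P root s'"
proof -
  obtain task_of lineage on place where "inv P root (frames s) (stacks s) (current s) (own s) (wsq s)
      task_of lineage on place" using assms(2) unfolding consistent_def by blast
  then interpret inv P root "frames s" "stacks s" "current s" "own s"
    "wsq s" task_of lineage on place .
  show ?thesis
    using assms(1)
  proof (cases rule: step.cases)
    case (fork w t f u r n)
    note inv_start[of w t f "Fork u" r True u n]
    with fork show ?thesis unfolding consistent_def by (simp add: start_child_def) blast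
  next
    case (call w t f u r n)
    note inv_start[of w t f "Call u" r False u n]
    with call show ?thesis unfolding consistent_def by (simp add: start_child_def) blast
  next
    case (steal w v p q f)
    then show ?thesis using inv_steal[of w v p q f] unfolding consistent_def by simp blast
  next
    case (join_unstolen w t f r)
    then show ?thesis using inv_join_unstolen[of w t f Join r] unfolding consistent_def
      by simp blast
  next
    case (join_last w t f r)
    moreover have "parent k \<noteq> Some t" if "frames s y = Some k" "forked k" for y k
      using join_last that by (auto simp: children_done_def)
    ultimately show ?thesis using inv_join_last[of w t f Join r] unfolding consistent_def
      by simp blast
  next
    case (join_wait w t f r)
    then obtain y k where "frames s y = Some k" "forked k" "parent k = Some t"
      by (auto simp: children_done_def)
    with join_wait show ?thesis using inv_join_wait[of w t f Join r y k] unfolding consistent_def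
      by simp blast
  next
    case (return_root w t f g)
    then have "wsq s w = []" using finished_queue(1) finished_unstolen by metis
    with return_root show ?thesis
      using inv_finish(1)[of w t f g] unfolding consistent_def by (simp add: drop_frame_def) blast
  next
    case (return_called w t f p g)
    then obtain fp where "frames s p = Some fp" using parent by blast
    with return_called show ?thesis
      using inv_resume[of w t f g p fp "wsq s w"] unfolding consistent_def
        by (simp add: drop_frame_def) blast
  next
    case (return_pop w t f p g q)
    then obtain fp where "frames s p = Some fp" using parent by blast
    with return_pop show ?thesis
      using inv_resume[of w t f g p fp q] unfolding consistent_def
        by (simp add: drop_frame_def) blast
  next
    case (return_last w t f p g s1 fp)
    then have fp: "frames s p = Some fp" by (auto simp: drop_frame_def split: if_splits)
    have "parent k \<noteq> Some p" if "y \<noteq> t" "frames s y = Some k" "forked k" for y k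
      using return_last that children_done_drop_frame by blast
    with return_last fp show ?thesis
      using inv_resume_last[of w t f g p fp] unfolding consistent_def
        by (simp add: drop_frame_def) blast
  next
    case (return_not_last w t f p g s1 fp)
    then have fp: "frames s p = Some fp" by (auto simp: drop_frame_def split: if_splits)
    have q: "wsq s w = []"
      using return_not_last finished_queue(2)[of w t f p] finished_unstolen[of w t f] by blast
    have "at_join fp \<longrightarrow> (\<exists>x h. x \<noteq> t \<and> frames s x = Some h \<and> forked h \<and> parent h = Some p)"
      using return_not_last children_done_drop_frame by blast
    with return_not_last fp have p: "\<And>p' fp. parent f = Some p' \<Longrightarrow> frames s p' = Some fp \<Longrightarrow> forked f \<and>
        (at_join fp \<longrightarrow> (\<exists>x g. x \<noteq> t \<and> frames s x = Some g \<and> forked g \<and> parent g = Some p'))"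
      by auto
    note fin = inv_finish[OF return_not_last(3-5) return_not_last(8) q p]
    show ?thesis
    proof (cases "own s w = home fp")
      case True
      with fin(2) return_not_last show ?thesis unfolding consistent_def
        by (simp add: drop_frame_def) blast
    next
      case False
      then have "own s w \<noteq> home fp'" if "parent f = Some p'" "frames s p' = Some fp'" for p' fp'
        using that return_not_last fp by auto
      with fin(1) False return_not_last show ?thesis unfolding consistent_def
        by (simp add: drop_frame_def) blast
    qed
  qed
qed

lemma consistent_reachable:
  assumes "reachable P root s" "fully_strict root"
  shows "consistent P root s"
proof -
  obtain s0 where "initial P root s0" "(step P)\<^sup>*\<^sup>* s0 s"
    using assms(1) unfolding reachable_def by blast
  from this(2) consistent_initial[OF this(1) assms(2)] show ?thesis
    by (induction rule: rtranclp_induct) (auto intro: consistent_step)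
qed

theorem theorem2:
  fixes root :: task and P c :: nat and s :: config
  assumes "P \<ge> 1"
    and "c \<ge> 2"
    and "nonempty_frames root"
    and "fully_strict root"
    and "reachable P root s"
  shows "stack_memory c s \<le> (2 * c + 3) * P * M1 root"
proof -
  obtain task_of lineage on place where "inv P root (frames s) (stacks s) (current s) (own s) (wsq s)
      task_of lineage on place"
    using consistent_reachable[OF assms(5,4)] unfolding consistent_def by blast
  from inv.memory_le[OF this assms(2,3)] show ?thesis by (simp add: stack_memory_def)
qed

end
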